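(* Let $p$ be a prime, $q\in\mathbb{C}_p$ with $|q-1|_p<p^{-\frac{1}{p-1}}$, $\lambda\in\mathbb{C}_p\setminus\{0\}$, and $x\in\mathbb{Z}_p$. For every integer $n\ge0$, \[ q\beta_{n,q}(x+1|\lambda)-\beta_{n,q}(x|\lambda)=(q-1)\lambda^n\left(\frac{[x]_q}{\lambda}\right)_n+\sum_{l=1}^{n}S_1(n,l)\lambda^{n-l}\,l\,[x]_q^{l-1}q^x, \] where $(a)_n=a(a-1)\cdots(a-n+1)$ (equal to $1$ for $n=0$).
   Context: $q^x=\exp(x\log q)$, $[x]_q=\frac{1-q^x}{1-q}$. The $p$-adic $q$-integral of a uniformly differentiable $f$ on $\mathbb{Z}_p$ is $\int_{\mathbb{Z}_p}f(y)\,d\mu_q(y)=\lim_{N\to\infty}\frac{1}{[p^N]_q}\sum_{y=0}^{p^N-1}f(y)q^y$. For $t\in\mathbb{C}_p$ with $|\lambda t|_p<p^{-1/(p-1)}$, $(1+\lambda t)^{a/\lambda}=\exp(\frac{a}{\lambda}\log(1+\lambda t))$, and the degenerate Carlitz $q$-Bernoulli polynomials $\beta_{n,q}(x|\lambda)$ are defined by $\int_{\mathbb{Z}_p}(1+\lambda t)^{\frac{1}{\lambda}[x+y]_q}\,d\mu_q(y)=\sum_{n\ge0}\beta_{n,q}(x|\lambda)\frac{t^n}{n!}$. $S_1(n,l)$ are the (signed) Stirling numbers of the first kind: $(x)_n=\sum_{l=0}^nS_1(n,l)x^l$. *)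

theory Defs
  imports "HOL-Analysis.Analysis" "HOL-Computational_Algebra.Computational_Algebra"
begin

text \<open>
  The library constant \<open>norm\<close> is tied to real normed vector spaces, hence a
  separate symbol for the absolute value. That \<open>vabs\<close> is nonnegative and vanishes
  only at 0 follows from the metric space axioms.
\<close>

class nonarch_field = field_char_0 + metric_space +
  fixes vabs :: "'a \<Rightarrow> real"
  assumes dist_vabs: "dist x y = vabs (x - y)"
    and vabs_mult: "vabs (x * y) = vabs x * vabs y"
    and vabs_ultrametric: "vabs (x + y) \<le> max (vabs x) (vabs y)"

text \<open>
  \<open>padic_numbers\<close> is \<open>\<rat>\<^sub>p\<close> as a subfield when the ambient field is complete and
  \<open>vabs p = 1 / p\<close>: the closure of the rationals is then their completion.
\<close>

definition padic_numbers :: "'a::nonarch_field set" where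
  "padic_numbers = closure \<rat>"

definition padic_integers :: "'a::nonarch_field set" where
  "padic_integers = {x \<in> padic_numbers. vabs x \<le> 1}"

definition algebraic_over_padics :: "'a::nonarch_field \<Rightarrow> bool" where
  "algebraic_over_padics x \<longleftrightarrow>
     (\<exists>f. f \<noteq> 0 \<and> (\<forall>i. poly.coeff f i \<in> padic_numbers) \<and> poly f x = 0)"

text \<open>
  A complete, algebraically closed field in which the algebraic closure of \<open>\<rat>\<^sub>p\<close>
  is dense is the completion of an algebraic closure of \<open>\<rat>\<^sub>p\<close>. So the following
  determines the field \<open>\<complex>\<^sub>p\<close>, with its normalised absolute value, up to isometric
  isomorphism.
\<close>

definition is_Cp ::
  "nat \<Rightarrow> 'a::{nonarch_field, complete_space, alg_closed_field} itself \<Rightarrow> bool" where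
  "is_Cp p _ \<longleftrightarrow> prime p \<and> vabs (of_nat p :: 'a) = 1 / real p \<and>
     closure {x::'a. algebraic_over_padics x} = UNIV"

definition exp_radius :: "nat \<Rightarrow> real" where
  "exp_radius p = real p powr (- 1 / (real p - 1))"

definition padic_exp :: "'a::nonarch_field \<Rightarrow> 'a" where
  "padic_exp z = (\<Sum>n. z ^ n / fact n)"

definition padic_log :: "'a::nonarch_field \<Rightarrow> 'a" where
  "padic_log z = (\<Sum>n. (- 1) ^ n * (z - 1) ^ Suc n / of_nat (Suc n))"

definition qpow :: "'a::nonarch_field \<Rightarrow> 'a \<Rightarrow> 'a" where
  "qpow q x = padic_exp (x * padic_log q)"

text \<open>At \<open>q = 1\<close> the quotient is read as its limit \<open>x\<close>.\<close>

definition qnum :: "'a::nonarch_field \<Rightarrow> 'a \<Rightarrow> 'a" where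
  "qnum q x = (if q = 1 then x else (1 - qpow q x) / (1 - q))"

definition padic_q_integral :: "nat \<Rightarrow> 'a::nonarch_field \<Rightarrow> ('a \<Rightarrow> 'a) \<Rightarrow> 'a" where
  "padic_q_integral p q f =
     lim (\<lambda>N. 1 / qnum q (of_nat (p ^ N)) * (\<Sum>y<p ^ N. f (of_nat y) * qpow q (of_nat y)))"

text \<open>\<open>degen_exp lam t a\<close> is \<open>(1 + lam t)\<close> to the power \<open>a / lam\<close>.\<close>

definition degen_exp :: "'a::nonarch_field \<Rightarrow> 'a \<Rightarrow> 'a \<Rightarrow> 'a" where
  "degen_exp lam t a = padic_exp (a / lam * padic_log (1 + lam * t))"

text \<open>
  The condition \<open>vabs t < exp_radius p\<close> matters only if \<open>vabs lam < 1\<close>: since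
  \<open>vabs (qnum q (x + y) / lam * padic_log (1 + lam * t)) = vabs (x + y) * vabs t\<close>,
  it is what makes the exponential in the integrand converge for all p-adic integers \<open>y\<close>.
\<close>

definition degen_carlitz :: "nat \<Rightarrow> 'a::nonarch_field \<Rightarrow> 'a \<Rightarrow> 'a \<Rightarrow> nat \<Rightarrow> 'a" where
  "degen_carlitz p q lam x =
     (THE b. \<forall>t. vabs (lam * t) < exp_radius p \<and> vabs t < exp_radius p \<longrightarrow>
        (\<lambda>n. b n * (t ^ n / fact n)) sums
          padic_q_integral p q (\<lambda>y. degen_exp lam t (qnum q (x + y))))"

definition falling_fact :: "'a::comm_ring_1 \<Rightarrow> nat \<Rightarrow> 'a" where
  "falling_fact a n = (\<Prod>i<n. a - of_nat i)"

definition stirling1 :: "nat \<Rightarrow> nat \<Rightarrow> int" where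
  "stirling1 n l = poly.coeff (falling_fact [:0, 1:] n) l"

end

theory Submission
  imports Defs
begin

text \<open>
  Put \<open>u(y) = [x + y]\<^sub>q\<close>. The binomial series gives
  \<open>(1 + \<lambda>t)\<^bsup>u(y)/\<lambda>\<^esup> = \<Sum>\<^sub>n A\<^sub>n(u(y)) t\<^sup>n / n!\<close> with \<open>A\<^sub>n(v) = \<Prod>i<n. (v - i\<lambda>)\<close>.
  Expanding \<open>A\<^sub>n(u(y))\<close> in the Newton basis \<open>\<Prod>i<k. ([y]\<^sub>q - [i]\<^sub>q)\<close>, whose \<open>q\<close>-weighted sums
  telescope, shows that the Riemann sums of \<open>A\<^sub>n(u(y))\<close> converge and are at most
  \<open>(n + 1) max(1, |\<lambda>|)\<^sup>n\<close> in absolute value. By dominated convergence their limits are the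
  coefficients \<open>\<beta>\<^sub>n\<^sub>,\<^sub>q(x|\<lambda>)\<close>. On Riemann sums the left-hand side of the claim telescopes to
  \<open>(q\<^sup>m A\<^sub>n([x + m]\<^sub>q) - A\<^sub>n([x]\<^sub>q)) / [m]\<^sub>q\<close> with \<open>m = p\<^sup>N\<close>. As \<open>[x + m]\<^sub>q = [x]\<^sub>q + q\<^sup>x [m]\<^sub>q\<close>
  and \<open>q\<^sup>m = 1 + (q - 1) [m]\<^sub>q\<close>, where \<open>[m]\<^sub>q\<close> tends to \<open>0\<close>, its limit is
  \<open>(q - 1) A\<^sub>n([x]\<^sub>q) + q\<^sup>x A\<^sub>n'([x]\<^sub>q)\<close>.
\<close>

section \<open>Non-archimedean analysis\<close>

context nonarch_field
begin

lemma vabs_eq_dist: "vabs x = dist x 0"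
  by (simp add: dist_vabs)

lemma vabs_zero [simp]: "vabs 0 = 0"
  by (simp add: vabs_eq_dist)

lemma vabs_nonneg [simp]: "0 \<le> vabs x"
  by (simp add: vabs_eq_dist)

lemma vabs_eq_0_iff [simp]: "vabs x = 0 \<longleftrightarrow> x = 0"
  by (simp add: vabs_eq_dist)

lemma vabs_pos_iff [simp]: "0 < vabs x \<longleftrightarrow> x \<noteq> 0"
  using vabs_nonneg[of x] vabs_eq_0_iff[of x] by linarith

lemma vabs_one [simp]: "vabs 1 = 1"
  using vabs_mult[of 1 1] vabs_eq_0_iff[of 1] by simp

lemma vabs_minus [simp]: "vabs (- x) = vabs x"
  using dist_commute[of x 0] by (simp add: dist_vabs)

lemma vabs_minus_commute: "vabs (x - y) = vabs (y - x)"
  using vabs_minus[of "x - y"] by simp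

lemma vabs_add_le: "vabs x \<le> B \<Longrightarrow> vabs y \<le> B \<Longrightarrow> vabs (x + y) \<le> B"
  using vabs_ultrametric[of x y] by simp

lemma vabs_diff_le: "vabs x \<le> B \<Longrightarrow> vabs y \<le> B \<Longrightarrow> vabs (x - y) \<le> B"
  using vabs_add_le[of x B "- y"] by simp

lemma vabs_power: "vabs (x ^ n) = vabs x ^ n"
  by (induction n) (simp_all add: vabs_mult)

lemma vabs_sum_le:
  assumes "\<And>i. i \<in> A \<Longrightarrow> vabs (f i) \<le> B" and "0 \<le> B"
  shows "vabs (sum f A) \<le> B"
  using assms
  by (induction A rule: infinite_finite_induct) (auto intro!: vabs_add_le)

lemma vabs_prod: "vabs (prod f A) = (\<Prod>i\<in>A. vabs (f i))"
  by (induction A rule: infinite_finite_induct) (simp_all add: vabs_mult)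

lemma vabs_prod_le_1: "(\<And>i. i \<in> A \<Longrightarrow> vabs (f i) \<le> 1) \<Longrightarrow> vabs (prod f A) \<le> 1"
  unfolding vabs_prod by (intro prod_le_1) auto

lemma vabs_of_nat_le_1 [simp]: "vabs (of_nat n) \<le> 1"
  by (induction n) (auto intro: vabs_add_le)

lemma vabs_of_int_le_1 [simp]: "vabs (of_int n) \<le> 1"
  by (cases n rule: int_cases2) auto

text \<open>Writing \<open>x\<close> as \<open>(x + y) + (- y)\<close>, the ultrametric inequality
  bounds \<open>vabs x\<close> by a maximum that \<open>vabs y\<close> is too small to attain; this
  is the reverse estimate.\<close>

lemma vabs_add_eq_left: "vabs y < vabs x \<Longrightarrow> vabs (x + y) = vabs x"
  using vabs_ultrametric[of x y] vabs_ultrametric[of "x + y" "- y"] by simp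

end

lemma vabs_inverse: "vabs (inverse x) = inverse (vabs x)" for x :: "'a::nonarch_field"
proof (cases "x = 0")
  case False
  then have "vabs x * vabs (inverse x) = 1"
    using vabs_mult[of x "inverse x"] by simp
  then show ?thesis
    by (rule inverse_unique[symmetric])
qed simp

lemma vabs_divide: "vabs (x / y) = vabs x / vabs y" for x :: "'a::nonarch_field"
  unfolding divide_inverse vabs_mult vabs_inverse ..

lemma tendsto_vabs_iff:
  fixes f :: "_ \<Rightarrow> 'a::nonarch_field"
  shows "(f \<longlongrightarrow> l) F \<longleftrightarrow> ((\<lambda>x. vabs (f x - l)) \<longlongrightarrow> 0) F"
  using tendsto_dist_iff[of f l F] by (simp add: dist_vabs)

lemma tendsto_zero_vabs_iff:
  fixes f :: "_ \<Rightarrow> 'a::nonarch_field"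
  shows "(f \<longlongrightarrow> 0) F \<longleftrightarrow> ((\<lambda>x. vabs (f x)) \<longlongrightarrow> 0) F"
  using tendsto_vabs_iff[of f 0 F] by simp

text \<open>With this instance and the next, the general rules for limits and infinite sums apply to
  the field.\<close>

instance nonarch_field \<subseteq> topological_ab_group_add
proof
  fix a b :: 'a
  have "((\<lambda>x. fst x + snd x :: 'a) \<longlongrightarrow> a + b) (nhds a \<times>\<^sub>F nhds b)"
    unfolding tendsto_vabs_iff
  proof (rule tendsto_sandwich[OF _ _ tendsto_const])
    have "((\<lambda>x. vabs (fst x - a)) \<longlongrightarrow> 0) (nhds a \<times>\<^sub>F nhds b)"
      and "((\<lambda>x. vabs (snd x - b)) \<longlongrightarrow> 0) (nhds a \<times>\<^sub>F nhds b)"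
      unfolding tendsto_vabs_iff[symmetric] by (rule filterlim_fst, rule filterlim_snd)
    then show "((\<lambda>x. vabs (fst x - a) + vabs (snd x - b)) \<longlongrightarrow> 0) (nhds a \<times>\<^sub>F nhds b)"
      by (rule tendsto_add_zero)
    have "vabs (fst x + snd x - (a + b)) \<le> vabs (fst x - a) + vabs (snd x - b)" for x
    proof -
      have "max (vabs (fst x - a)) (vabs (snd x - b)) \<le> vabs (fst x - a) + vabs (snd x - b)"
        by simp
      then show ?thesis
        using vabs_ultrametric[of "fst x - a" "snd x - b"]
        by (simp only: add_diff_add)
    qed
    then show "\<forall>\<^sub>F x in nhds a \<times>\<^sub>F nhds b.
        vabs (fst x + snd x - (a + b)) \<le> vabs (fst x - a) + vabs (snd x - b)"
      by simp
  qed simp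
  then show "LIM x (nhds a \<times>\<^sub>F nhds b). fst x + snd x :> nhds (a + b)" .
  show "(uminus \<longlongrightarrow> - a) (nhds a)"
    using filterlim_ident[of "nhds a"]
    unfolding tendsto_vabs_iff minus_diff_minus vabs_minus .
qed

instance nonarch_field \<subseteq> topological_comm_monoid_mult
proof
  fix a b :: 'a
  have "((\<lambda>x. fst x * snd x :: 'a) \<longlongrightarrow> a * b) (nhds a \<times>\<^sub>F nhds b)"
    unfolding tendsto_vabs_iff
  proof (rule tendsto_sandwich[OF _ _ tendsto_const])
    define u v where "u = (\<lambda>x::'a \<times> 'a. vabs (fst x - a))" and "v = (\<lambda>x::'a \<times> 'a. vabs (snd x - b))"
    have uv: "(u \<longlongrightarrow> 0) (nhds a \<times>\<^sub>F nhds b)" "(v \<longlongrightarrow> 0) (nhds a \<times>\<^sub>F nhds b)"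
      unfolding tendsto_vabs_iff[symmetric] u_def v_def
      by (rule filterlim_fst, rule filterlim_snd)
    have "((\<lambda>x. u x * v x + u x * vabs b + vabs a * v x) \<longlongrightarrow> 0 * 0 + 0 * vabs b + vabs a * 0)
        (nhds a \<times>\<^sub>F nhds b)"
      by (intro tendsto_add tendsto_mult tendsto_const uv)
    then show "((\<lambda>x. u x * v x + u x * vabs b + vabs a * v x) \<longlongrightarrow> 0) (nhds a \<times>\<^sub>F nhds b)"
      by simp
    have "vabs (fst x * snd x - a * b) \<le> u x * v x + u x * vabs b + vabs a * v x" for x
    proof -
      have "fst x * snd x - a * b = (fst x - a) * (snd x - b) + (fst x - a) * b + a * (snd x - b)"
        by (simp add: algebra_simps)
      then have "vabs (fst x * snd x - a * b) \<le> max (max (u x * v x) (u x * vabs b)) (vabs a * v x)"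
        using vabs_ultrametric[of "(fst x - a) * (snd x - b) + (fst x - a) * b" "a * (snd x - b)"]
          vabs_ultrametric[of "(fst x - a) * (snd x - b)" "(fst x - a) * b"]
        by (auto simp: vabs_mult u_def v_def)
      moreover have "u x * v x \<ge> 0" "u x * vabs b \<ge> 0" "vabs a * v x \<ge> 0"
        by (simp_all add: u_def v_def)
      ultimately show ?thesis
        by linarith
    qed
    then show "\<forall>\<^sub>F x in nhds a \<times>\<^sub>F nhds b.
        vabs (fst x * snd x - a * b) \<le> u x * v x + u x * vabs b + vabs a * v x"
      by simp
  qed simp
  then show "LIM x (nhds a \<times>\<^sub>F nhds b). fst x * snd x :> nhds (a * b)" .
qed

section \<open>Convergence of series\<close>

lemma vabs_tendsto_le:
  fixes f :: "nat \<Rightarrow> 'a::nonarch_field"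
  assumes "f \<longlonglongrightarrow> l" and "eventually (\<lambda>n. vabs (f n) \<le> B) sequentially"
  shows "vabs l \<le> B"
proof -
  have "(\<lambda>n. dist (f n) 0) \<longlonglongrightarrow> dist l 0"
    using assms(1) by (intro tendsto_intros)
  then have "(\<lambda>n. vabs (f n)) \<longlonglongrightarrow> vabs l"
    by (simp add: vabs_eq_dist)
  then show ?thesis
    using assms(2) by (rule tendsto_upperbound) simp
qed

lemma sums_cmult:
  fixes f :: "nat \<Rightarrow> 'a::nonarch_field"
  shows "f sums s \<Longrightarrow> (\<lambda>n. c * f n) sums (c * s)"
  unfolding sums_def by (simp add: sum_distrib_left[symmetric] tendsto_mult_left)

lemma sums_imp_null:
  fixes f :: "nat \<Rightarrow> 'a::nonarch_field"
  assumes "f sums s"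
  shows "f \<longlonglongrightarrow> 0"
proof -
  have "(\<lambda>n. (\<Sum>i<Suc n. f i) - (\<Sum>i<n. f i)) \<longlonglongrightarrow> s - s"
    using assms unfolding sums_def by (intro tendsto_diff) (rule LIMSEQ_Suc)
  then show ?thesis by simp
qed

text \<open>Any finite block of terms from \<open>m\<close> on is at most \<open>B\<close> by the
  ultrametric inequality, however long it is, and the bound survives the limit.\<close>

lemma vabs_tail_le:
  fixes f :: "nat \<Rightarrow> 'a::nonarch_field"
  assumes "f sums s" and "\<And>n. n \<ge> m \<Longrightarrow> vabs (f n) \<le> B"
  shows "vabs (s - (\<Sum>n<m. f n)) \<le> B"
proof (rule vabs_tendsto_le)
  show "(\<lambda>k. (\<Sum>n<k. f n) - (\<Sum>n<m. f n)) \<longlonglongrightarrow> s - (\<Sum>n<m. f n)"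
    using assms(1) unfolding sums_def by (intro tendsto_intros)
  have "0 \<le> B"
    using assms(2)[of m] vabs_nonneg[of "f m"] by linarith
  then have "vabs ((\<Sum>n<k. f n) - (\<Sum>n<m. f n)) \<le> B" if "k \<ge> m" for k
    using assms(2) sum_diff_nat_ivl[of 0 m k f] that
    by (auto simp: lessThan_atLeast0 intro!: vabs_sum_le)
  then show "\<forall>\<^sub>F k in sequentially. vabs ((\<Sum>n<k. f n) - (\<Sum>n<m. f n)) \<le> B"
    by (auto simp: eventually_sequentially)
qed

lemma vabs_sums_le:
  fixes f :: "nat \<Rightarrow> 'a::nonarch_field"
  assumes "f sums s" and "\<And>n. vabs (f n) \<le> B"
  shows "vabs s \<le> B"
  using vabs_tail_le[of f s 0 B] assms by simp

text \<open>A block of the series is no larger than its largest term, so null terms already make the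
  partial sums Cauchy.\<close>

lemma summable_null:
  fixes f :: "nat \<Rightarrow> 'a::{nonarch_field, complete_space}"
  assumes "f \<longlonglongrightarrow> 0"
  shows "summable f"
proof -
  have "Cauchy (\<lambda>n. \<Sum>i<n. f i)"
  proof (rule metric_CauchyI)
    fix e :: real assume "e > 0"
    obtain M where M: "\<And>n. n \<ge> M \<Longrightarrow> vabs (f n) < e / 2"
      using metric_LIMSEQ_D[OF assms, of "e / 2"] \<open>e > 0\<close> by (auto simp: dist_vabs)
    have *: "vabs ((\<Sum>i<n. f i) - (\<Sum>i<M. f i)) \<le> e / 2" if "n \<ge> M" for n
    proof -
      have "vabs (\<Sum>i=M..<n. f i) \<le> e / 2"
        using M \<open>e > 0\<close> by (intro vabs_sum_le less_imp_le) auto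
      then show ?thesis
        using sum_diff_nat_ivl[of 0 M n f] that by (simp add: lessThan_atLeast0)
    qed
    have "dist (\<Sum>i<m. f i) (\<Sum>i<n. f i) < e" if "m \<ge> M" "n \<ge> M" for m n
      using vabs_diff_le[OF *[OF that(1)] *[OF that(2)]] \<open>e > 0\<close> by (simp add: dist_vabs)
    then show "\<exists>M. \<forall>m\<ge>M. \<forall>n\<ge>M. dist (\<Sum>i<m. f i) (\<Sum>i<n. f i) < e"
      by blast
  qed
  then show ?thesis
    by (simp add: summable_iff_convergent Cauchy_convergent_iff)
qed

text \<open>Exchange of summation, used for Cauchy products and for the binomial series. Smallness
  of \<open>T k n\<close> uniformly in \<open>k\<close> takes the place of absolute
  convergence.\<close>

lemma triangular_double_sum:
  fixes T :: "nat \<Rightarrow> nat \<Rightarrow> 'a::{nonarch_field, complete_space}"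
  assumes zero: "\<And>k n. n < k \<Longrightarrow> T k n = 0"
    and small: "\<And>e. e > 0 \<Longrightarrow> \<exists>M. \<forall>n\<ge>M. \<forall>k\<le>n. vabs (T k n) \<le> e"
    and A: "\<And>k. T k sums A k"
    and S: "A sums S"
  shows "(\<lambda>n. \<Sum>k\<le>n. T k n) sums S"
proof -
  have tri: "(\<Sum>n<m. \<Sum>k\<le>n. T k n) = (\<Sum>k<m. \<Sum>n<m. T k n)" for m
  proof -
    have "(\<Sum>n<m. \<Sum>k\<le>n. T k n) = (\<Sum>n<m. \<Sum>k<m. T k n)"
      by (intro sum.cong refl sum.mono_neutral_left) (auto simp: zero)
    also have "\<dots> = (\<Sum>k<m. \<Sum>n<m. T k n)"
      by (rule sum.swap)
    finally show ?thesis .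
  qed
  \<comment> \<open>By \<open>tri\<close> the difference is a sum of \<open>m\<close> row tails;
    each is at most \<open>e / 2\<close>, hence so is their sum, whatever \<open>m\<close>
    is.\<close>
  have "(\<lambda>m. (\<Sum>k<m. A k) - (\<Sum>n<m. \<Sum>k\<le>n. T k n)) \<longlonglongrightarrow> 0"
  proof (rule metric_LIMSEQ_I)
    fix e :: real assume "e > 0"
    then obtain M where M: "\<And>n k. n \<ge> M \<Longrightarrow> k \<le> n \<Longrightarrow> vabs (T k n) \<le> e / 2"
      using small[of "e / 2"] by auto
    have "vabs (T k n) \<le> e / 2" if "n \<ge> M" for n k
      using M[OF that] zero[of n k] \<open>e > 0\<close> by (cases "k \<le> n") auto
    then have *: "vabs (A k - (\<Sum>n<m. T k n)) \<le> e / 2" if "m \<ge> M" for m k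
      using that by (intro vabs_tail_le[OF A]) auto
    have "vabs ((\<Sum>k<m. A k) - (\<Sum>n<m. \<Sum>k\<le>n. T k n)) \<le> e / 2" if "m \<ge> M" for m
      unfolding tri sum_subtractf[symmetric] using *[OF that] \<open>e > 0\<close> by (intro vabs_sum_le) auto
    then show "\<exists>M. \<forall>m\<ge>M. dist ((\<Sum>k<m. A k) - (\<Sum>n<m. \<Sum>k\<le>n. T k n)) 0 < e"
      using \<open>e > 0\<close> by (intro exI[of _ M]) (force simp: dist_vabs)
  qed
  from tendsto_diff[OF S[unfolded sums_def] this] show ?thesis
    by (simp add: sums_def)
qed

lemma null_bounded:
  fixes f :: "nat \<Rightarrow> 'a::nonarch_field"
  assumes "f \<longlonglongrightarrow> 0"
  obtains C where "C > 0" "\<And>n. vabs (f n) \<le> C"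
proof -
  have "bounded (range f)"
    using assms by (rule convergent_imp_bounded)
  then obtain C where "\<And>n. dist 0 (f n) \<le> C"
    unfolding bounded_any_center[of _ 0] by auto
  then have "\<And>n. vabs (f n) \<le> max C 1"
    by (simp add: vabs_eq_dist dist_commute le_max_iff_disj)
  then show ?thesis
    by (intro that[of "max C 1"]) auto
qed

lemma null_eventually_le:
  fixes f :: "nat \<Rightarrow> 'a::nonarch_field"
  assumes "f \<longlonglongrightarrow> 0" "e > 0"
  obtains M where "\<And>n. n \<ge> M \<Longrightarrow> vabs (f n) \<le> e"
  using metric_LIMSEQ_D[OF assms] by (auto simp: dist_vabs intro: less_imp_le)

lemma Cauchy_product_nonarch:
  fixes f g :: "nat \<Rightarrow> 'a::{nonarch_field, complete_space}"
  assumes f: "f sums a" and g: "g sums b"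
  shows "(\<lambda>n. \<Sum>k\<le>n. f k * g (n - k)) sums (a * b)"
proof -
  define T where "T k n = (if k \<le> n then f k * g (n - k) else 0)" for k n
  have "(\<lambda>n. \<Sum>k\<le>n. T k n) sums (a * b)"
  proof (rule triangular_double_sum)
    show "T k n = 0" if "n < k" for k n
      using that by (simp add: T_def)
    show "T k sums (f k * b)" for k
    proof -
      have "(\<lambda>n. f k * g n) sums (f k * b)"
        using g by (rule sums_cmult)
      \<comment> \<open>Row \<open>k\<close> is the series \<open>f k * g n\<close> delayed by
        \<open>k\<close> zero entries.\<close>
      then have "(\<lambda>n. \<Sum>i<n + k. T k i) \<longlonglongrightarrow> f k * b"
      proof -
        have "(\<Sum>i<n + k. T k i) = (\<Sum>i<n. f k * g i)" for n
          by (induction n) (simp_all add: T_def)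
        then show ?thesis
          using \<open>(\<lambda>n. f k * g n) sums _\<close> by (simp add: sums_def)
      qed
      then show ?thesis
        unfolding sums_def by (rule LIMSEQ_offset)
    qed
    show "(\<lambda>k. f k * b) sums (a * b)"
      using sums_cmult[OF f, of b] by (simp add: mult.commute)
    fix e :: real assume "e > 0"
    obtain C D where C: "C > 0" "\<And>n. vabs (f n) \<le> C" and D: "D > 0" "\<And>n. vabs (g n) \<le> D"
      using null_bounded[OF sums_imp_null[OF f]] null_bounded[OF sums_imp_null[OF g]] by metis
    obtain M where M: "\<And>n. n \<ge> M \<Longrightarrow> vabs (f n) \<le> e / D"
      using null_eventually_le[OF sums_imp_null[OF f], of "e / D"] \<open>e > 0\<close> D(1) by auto
    obtain N where N: "\<And>n. n \<ge> N \<Longrightarrow> vabs (g n) \<le> e / C"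
      using null_eventually_le[OF sums_imp_null[OF g], of "e / C"] \<open>e > 0\<close> C(1) by auto
    \<comment> \<open>Either \<open>k\<close> or \<open>n - k\<close> is large, so one factor is
      small while the other stays bounded.\<close>
    have "vabs (T k n) \<le> e" if "n \<ge> M + N" "k \<le> n" for k n
    proof (cases "k \<ge> M")
      case True
      have "vabs (f k) * vabs (g (n - k)) \<le> e / D * D"
        using M[OF True] D \<open>e > 0\<close> by (intro mult_mono) auto
      then show ?thesis using that D(1) by (simp add: T_def vabs_mult)
    next
      case False
      have "vabs (f k) * vabs (g (n - k)) \<le> C * (e / C)"
        using N[of "n - k"] C False that by (intro mult_mono) auto
      then show ?thesis using that C(1) by (simp add: T_def vabs_mult)
    qed
    then show "\<exists>M. \<forall>n\<ge>M. \<forall>k\<le>n. vabs (T k n) \<le> e"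
      by blast
  qed
  moreover have "(\<Sum>k\<le>n. T k n) = (\<Sum>k\<le>n. f k * g (n - k))" for n
    by (intro sum.cong) (auto simp: T_def)
  ultimately show ?thesis by simp
qed

text \<open>Dominated convergence: heads converge termwise, and both tails are controlled by
  \<open>B\<close>. Since tails are bounded by their largest term, \<open>B\<close> has to be null
  but not summable.\<close>

lemma dominated_sums:
  fixes u :: "nat \<Rightarrow> nat \<Rightarrow> 'a::{nonarch_field, complete_space}"
  assumes u: "\<And>n. (\<lambda>N. u N n) \<longlonglongrightarrow> v n"
    and bound: "\<And>N n. vabs (u N n) \<le> B n"
    and B: "B \<longlonglongrightarrow> 0"
    and s: "\<And>N. u N sums s N"
  obtains l where "v sums l" "s \<longlonglongrightarrow> l"
proof -
  have vB: "vabs (v n) \<le> B n" for n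
    using u by (rule vabs_tendsto_le) (simp add: bound)
  have "(\<lambda>n. vabs (v n)) \<longlonglongrightarrow> 0"
    by (rule tendsto_sandwich[OF _ _ tendsto_const B]) (simp_all add: vB)
  then have "summable v"
    by (intro summable_null) (simp add: tendsto_zero_vabs_iff)
  then obtain l where l: "v sums l"
    by (auto simp: summable_def)
  have "s \<longlonglongrightarrow> l"
  proof (rule metric_LIMSEQ_I)
    fix e :: real assume "e > 0"
    obtain m where m: "\<And>n. n \<ge> m \<Longrightarrow> B n \<le> e / 2"
      using order_tendstoD(2)[OF B, of "e / 2"] \<open>e > 0\<close>
      by (auto simp: eventually_sequentially intro: less_imp_le)
    have "(\<lambda>N. (\<Sum>n<m. u N n) - (\<Sum>n<m. v n)) \<longlonglongrightarrow> (\<Sum>n<m. v n) - (\<Sum>n<m. v n)"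
      by (intro tendsto_intros u)
    then have "(\<lambda>N. (\<Sum>n<m. u N n) - (\<Sum>n<m. v n)) \<longlonglongrightarrow> 0" by simp
    then obtain M where M: "\<And>N. N \<ge> M \<Longrightarrow> vabs ((\<Sum>n<m. u N n) - (\<Sum>n<m. v n)) \<le> e / 2"
      using null_eventually_le \<open>e > 0\<close> by (metis half_gt_zero)
    have "dist (s N) l < e" if "N \<ge> M" for N
    proof -
      have 1: "vabs (s N - (\<Sum>n<m. u N n)) \<le> e / 2"
        using order_trans[OF bound m] by (intro vabs_tail_le[OF s])
      have 2: "vabs (l - (\<Sum>n<m. v n)) \<le> e / 2"
        using order_trans[OF vB m] by (intro vabs_tail_le[OF l])
      have "s N - l = (s N - (\<Sum>n<m. u N n)) + ((\<Sum>n<m. u N n) - (\<Sum>n<m. v n)) - (l - (\<Sum>n<m. v n))"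
        by simp
      then have "vabs (s N - l) \<le> e / 2"
        using vabs_diff_le[OF vabs_add_le[OF 1 M[OF that]] 2] by simp
      then show ?thesis
        using \<open>e > 0\<close> by (simp add: dist_vabs)
    qed
    then show "\<exists>M. \<forall>N\<ge>M. dist (s N) l < e" by blast
  qed
  with l show ?thesis by (rule that)
qed

text \<open>Uniqueness of power series coefficients, which makes the \<open>THE\<close> in
  \<open>degen_carlitz\<close> well defined. Evaluation at ever smaller points
  \<open>t * \<pi> ^ i\<close> isolates the first nonzero term and forces it to vanish.\<close>

lemma power_series_zero_imp_zero:
  fixes d :: "nat \<Rightarrow> 'a::nonarch_field" and \<pi> :: 'a
  assumes "\<rho> > 0" and sums: "\<And>t. vabs t < \<rho> \<Longrightarrow> (\<lambda>n. d n * t ^ n) sums 0"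
    and pi: "\<pi> \<noteq> 0" "vabs \<pi> < 1"
  shows "d n = 0"
proof (rule ccontr)
  assume "d n \<noteq> 0"
  define k where "k = (LEAST n. d n \<noteq> 0)"
  have k: "d k \<noteq> 0" and below: "\<And>i. i < k \<Longrightarrow> d i = 0"
    unfolding k_def using \<open>d n \<noteq> 0\<close> by (rule LeastI) (auto dest: not_less_Least)
  \<comment> \<open>Powers of \<pi> supply a nonzero point inside the disc of radius \<rho>.\<close>
  have "(\<lambda>j. vabs \<pi> ^ j) \<longlonglongrightarrow> 0"
    using pi(2) by (intro LIMSEQ_power_zero) simp
  then have "eventually (\<lambda>j. vabs \<pi> ^ j < \<rho>) sequentially"
    using \<open>\<rho> > 0\<close> by (rule order_tendstoD)
  then obtain j where j: "vabs \<pi> ^ j < \<rho>"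
    by (auto simp: eventually_sequentially)
  define t where "t = \<pi> ^ j"
  have t: "t \<noteq> 0" "vabs t < \<rho>"
    using pi j by (simp_all add: t_def vabs_power)
  obtain C where C: "C > 0" "\<And>n. vabs (d n * t ^ n) \<le> C"
    using null_bounded[OF sums_imp_null[OF sums[OF t(2)]]] by blast
  have *: "vabs (d k * t ^ k) \<le> C * vabs \<pi> ^ i" for i
  proof -
    define w where "w = t * \<pi> ^ i"
    have pile: "vabs \<pi> ^ i \<le> 1"
      using pi(2) by (simp add: power_le_one)
    then have "vabs w < \<rho>"
      using t(2) mult_left_le[of "vabs \<pi> ^ i" "vabs t"] by (simp add: w_def vabs_mult vabs_power)
    then have S: "(\<lambda>n. d n * w ^ n) sums 0" by (rule sums)
    \<comment> \<open>Beyond index \<open>k\<close> every term carries at least one factor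
      \<open>vabs \<pi> ^ i\<close> more than term \<open>k\<close> does.\<close>
    have "vabs (0 - (\<Sum>n<Suc k. d n * w ^ n)) \<le> C * vabs \<pi> ^ (i * Suc k)"
    proof (rule vabs_tail_le[OF S])
      fix n assume "n \<ge> Suc k"
      have "vabs (d n * w ^ n) = vabs (d n * t ^ n) * vabs \<pi> ^ (i * n)"
        by (simp add: w_def vabs_mult vabs_power power_mult_distrib power_mult)
      also have "\<dots> \<le> C * vabs \<pi> ^ (i * Suc k)"
        using C pi(2) \<open>n \<ge> Suc k\<close> by (intro mult_mono power_decreasing) auto
      finally show "vabs (d n * w ^ n) \<le> C * vabs \<pi> ^ (i * Suc k)" .
    qed
    moreover have "(\<Sum>n<k. d n * w ^ n) = 0"
      using below by (intro sum.neutral) auto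
    ultimately have "vabs (d k * t ^ k) * vabs \<pi> ^ (i * k) \<le> (C * vabs \<pi> ^ i) * vabs \<pi> ^ (i * k)"
      by (simp add: w_def vabs_mult vabs_power power_mult_distrib power_mult[symmetric]
          power_add mult_ac)
    then show ?thesis
      using pi(1) by (simp add: mult_le_cancel_right)
  qed
  have "(\<lambda>i. C * vabs \<pi> ^ i) \<longlonglongrightarrow> C * 0"
    using pi(2) by (intro tendsto_mult_left LIMSEQ_power_zero) simp
  then have "vabs (d k * t ^ k) \<le> C * 0"
    by (rule LIMSEQ_le_const) (auto intro: *)
  moreover have "vabs (d k * t ^ k) > 0"
    using k t(1) by simp
  ultimately show False by simp
qed

section \<open>Stirling numbers and powers of the logarithm series\<close>

unbundle no vec_syntax

lemma falling_fact_0 [simp]: "falling_fact a 0 = 1"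
  by (simp add: falling_fact_def)

lemma falling_fact_Suc: "falling_fact a (Suc n) = falling_fact a n * (a - of_nat n)"
  by (simp add: falling_fact_def)

lemma stirling1_0: "stirling1 0 k = (if k = 0 then 1 else 0)"
  by (simp add: stirling1_def)

lemma stirling1_Suc_Suc:
  "stirling1 (Suc n) (Suc k) = stirling1 n k - int n * stirling1 n (Suc k)"
  unfolding stirling1_def falling_fact_Suc
  by (simp add: right_diff_distrib of_nat_poly mult.commute[of _ "[:_, 1:]"] mult.commute[of _ "[:_:]"])

lemma stirling1_Suc_0 [simp]: "stirling1 (Suc n) 0 = 0"
  by (induction n) (simp_all add: stirling1_def falling_fact_Suc right_diff_distrib of_nat_poly
      mult.commute[of _ "[:_, 1:]"] mult.commute[of _ "[:_:]"])

lemma stirling1_eq_0: "n < k \<Longrightarrow> stirling1 n k = 0"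
proof (induction n arbitrary: k)
  case 0
  then show ?case by (simp add: stirling1_0)
next
  case (Suc n)
  then show ?case by (cases k) (simp_all add: stirling1_Suc_Suc)
qed

text \<open>The numbers are coefficients of an integer polynomial; induction along their recurrence
  transfers the expansion to any commutative ring.\<close>

lemma falling_fact_conv_stirling1:
  fixes c :: "'a::comm_ring_1"
  shows "falling_fact c n = (\<Sum>k\<le>n. of_int (stirling1 n k) * c ^ k)"
proof (induction n)
  case 0
  then show ?case by (simp add: stirling1_0)
next
  case (Suc n)
  have "(\<Sum>k\<le>Suc n. of_int (stirling1 (Suc n) k) * c ^ k) =
      (\<Sum>k\<le>n. of_int (stirling1 n k) * c ^ Suc k) -
      of_nat n * (\<Sum>k\<le>n. of_int (stirling1 n (Suc k)) * c ^ Suc k)"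
    by (subst sum.atMost_Suc_shift)
      (simp add: stirling1_Suc_Suc algebra_simps sum_subtractf sum_distrib_left)
  also have "(\<Sum>k\<le>n. of_int (stirling1 n (Suc k)) * c ^ Suc k) =
      falling_fact c n - of_int (stirling1 n 0)"
    using sum.atMost_Suc_shift[of "\<lambda>k. of_int (stirling1 n k) * c ^ k" n]
    by (simp add: Suc stirling1_eq_0)
  \<comment> \<open>For \<open>n = 0\<close> the outer factor vanishes, and for \<open>n > 0\<close>
    the number \<open>stirling1 n 0\<close> does.\<close>
  also have "of_nat n * (falling_fact c n - of_int (stirling1 n 0)) = of_nat n * falling_fact c n"
    by (cases n) (simp_all add: algebra_simps)
  also have "(\<Sum>k\<le>n. of_int (stirling1 n k) * c ^ Suc k) = c * falling_fact c n"
    by (simp add: Suc sum_distrib_left algebra_simps)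
  finally show ?case
    by (simp add: falling_fact_Suc algebra_simps)
qed

text \<open>With \<open>L = fps_ln 1\<close> one has \<open>(1 + X) L' = 1\<close>, hence
  \<open>(1 + X) (L^(j+1))' = (j+1) L^j\<close>. Comparing coefficients yields the Stirling
  recurrence.\<close>

lemma fps_ln_power_nth:
  "(fps_ln 1 ^ k :: 'a::field_char_0 fps) $ n = fact k * of_int (stirling1 n k) / fact n"
proof (induction n arbitrary: k)
  case 0
  show ?case by (cases k) (simp_all add: stirling1_0)
next
  case (Suc n)
  show ?case
  proof (cases k)
    case (Suc j)
    let ?L = "fps_ln 1 :: 'a fps"
    have "(1 + fps_X) * fps_deriv (?L ^ Suc j) =
        fps_const (of_nat (Suc j)) * ?L ^ j * ((1 + fps_X) * inverse (1 + fps_X))"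
      by (simp only: fps_deriv_power fps_ln_deriv) (simp add: mult_ac)
    also have "(1 + fps_X :: 'a fps) * inverse (1 + fps_X) = 1"
      by (rule inverse_mult_eq_1') simp
    finally have "((1 + fps_X) * fps_deriv (?L ^ Suc j)) $ n = (fps_const (of_nat (Suc j)) * ?L ^ j) $ n"
      by simp
    then have *: "of_nat (Suc n) * (?L ^ Suc j) $ Suc n + of_nat n * (?L ^ Suc j) $ n
        = of_nat (Suc j) * (?L ^ j) $ n"
      by (cases n) (simp_all add: distrib_right fps_mult_left_const_nth del: power_Suc)
    have "of_nat (Suc n) * (?L ^ Suc j) $ Suc n =
        of_nat (Suc j) * (?L ^ j) $ n - of_nat n * (?L ^ Suc j) $ n"
      using * by (simp only: eq_diff_eq)
    also have "\<dots> = fact (Suc j) * of_int (stirling1 (Suc n) (Suc j)) / fact n"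
      by (simp only: Suc.IH stirling1_Suc_Suc) (simp add: field_simps)
    also have "\<dots> = of_nat (Suc n) * (fact (Suc j) * of_int (stirling1 (Suc n) (Suc j)) / fact (Suc n))"
      by (simp only: fact_Suc) (simp add: divide_simps del: of_nat_Suc)
    finally show ?thesis
      unfolding Suc by (simp only: mult_left_cancel[OF of_nat_neq_0])
  qed simp
qed

lemma prod_diff_of_nat_mult:
  fixes a lam :: "'a::field"
  assumes "lam \<noteq> 0"
  shows "(\<Prod>i<n. a - of_nat i * lam) = lam ^ n * falling_fact (a / lam) n"
  by (induction n) (simp_all add: falling_fact_Suc right_diff_distrib assms)

lemma prod_diff_conv_stirling1:
  fixes a lam :: "'a::field"
  assumes "lam \<noteq> 0"
  shows "(\<Prod>i<n. a - of_nat i * lam) = (\<Sum>k\<le>n. of_int (stirling1 n k) * lam ^ (n - k) * a ^ k)"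
  unfolding prod_diff_of_nat_mult[OF assms] falling_fact_conv_stirling1 sum_distrib_left
  by (intro sum.cong) (auto simp: assms power_diff power_divide)

section \<open>The \<open>p\<close>-adic exponential and logarithm\<close>

locale padic_field =
  fixes p :: nat and ty :: "'a::{nonarch_field, complete_space} itself"
  assumes prime_p: "prime p" and vabs_p: "vabs (of_nat p :: 'a) = 1 / real p"
begin

section \<open>The radius of convergence and absolute values of integers and factorials\<close>

abbreviation r :: real where "r \<equiv> exp_radius p"

lemma p_gt_1: "p > 1"
  using prime_p by (rule prime_gt_1_nat)

lemma r_pos [simp]: "0 < r"
  using p_gt_1 by (simp add: exp_radius_def)

lemma r_nonneg [simp]: "0 \<le> r"
  using r_pos by linarith

lemma r_neq_0 [simp]: "r \<noteq> 0"
  using r_pos by linarith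

lemma r_less_1: "r < 1"
  using p_gt_1 by (simp add: exp_radius_def powr_less_one divide_less_0_iff)

text \<open>In estimates of factorials, each factor \<open>p\<close> thus costs exactly
  \<open>p - 1\<close> factors \<open>r\<close>.\<close>

lemma r_power: "r ^ (p - 1) = 1 / real p"
  using p_gt_1 by (simp add: exp_radius_def powr_powr of_nat_diff flip: powr_realpow)

text \<open>In a Bezout relation \<open>u k + v p = 1\<close> the second summand has absolute value
  below 1, so the first has at least 1; as \<open>u\<close> is an integer, this falls to
  \<open>k\<close>.\<close>

lemma vabs_of_nat_not_dvd:
  assumes "\<not> p dvd k"
  shows "vabs (of_nat k :: 'a) = 1"
proof (rule antisym)
  have "coprime (int k) (int p)"
    using prime_imp_coprime[OF prime_p assms] by (simp add: coprime_commute)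
  then obtain u v where "u * int k + v * int p = 1"
    using bezout_int[of "int k" "int p"] by auto
  then have eq: "of_int u * of_nat k + of_int v * of_nat p = (1 :: 'a)"
    by (metis of_int_1 of_int_add of_int_mult of_int_of_nat_eq)
  have "vabs (of_int v * of_nat p :: 'a) \<le> 1 * vabs (of_nat p :: 'a)"
    unfolding vabs_mult by (intro mult_right_mono) auto
  also have "\<dots> < 1"
    using p_gt_1 by (simp add: vabs_p)
  finally have "vabs (of_int v * of_nat p :: 'a) < 1" .
  then have "1 \<le> vabs (of_int u * of_nat k :: 'a)"
    using vabs_ultrametric[of "of_int u * of_nat k" "of_int v * of_nat p :: 'a"] by (simp add: eq)
  also have "\<dots> \<le> 1 * vabs (of_nat k :: 'a)"
    unfolding vabs_mult by (intro mult_right_mono) auto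
  finally show "1 \<le> vabs (of_nat k :: 'a)" by simp
qed simp

text \<open>Removing a factor \<open>p\<close> scales both sides by \<open>1 / p\<close>. The bound
  later limits the moments of the Newton basis to linear growth.\<close>

lemma vabs_of_nat_ge:
  assumes "n > 0"
  shows "1 / real n \<le> vabs (of_nat n :: 'a)"
  using assms
proof (induction n rule: less_induct)
  case (less n)
  show ?case
  proof (cases "p dvd n")
    case True
    then obtain m where m: "n = p * m" by blast
    have "m < n" "m > 0"
      using less.prems p_gt_1 by (auto simp: m)
    then have "1 / real p * (1 / real m) \<le> 1 / real p * vabs (of_nat m :: 'a)"
      using less.IH by (intro mult_left_mono) auto
    then show ?thesis
      by (simp add: m vabs_mult vabs_p)
  qed (use less.prems vabs_of_nat_not_dvd in auto)
qed

lemma vabs_fact_mult_add: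
  assumes "j < p"
  shows "vabs (fact (p * m + j) :: 'a) = vabs (fact (p * m) :: 'a)"
  using assms
proof (induction j)
  case (Suc j)
  have "\<not> p dvd Suc (p * m + j)"
    using Suc.prems
    by (metis add_Suc_right dvd_add_right_iff dvd_triv_left nat_dvd_not_less zero_less_Suc)
  then have "vabs (of_nat (Suc (p * m + j)) :: 'a) = 1"
    by (rule vabs_of_nat_not_dvd)
  then show ?case
    using Suc by (simp add: vabs_mult del: of_nat_Suc)
qed simp

text \<open>Among the factors of \<open>(p m)!\<close> the multiples of \<open>p\<close> contribute
  \<open>p^m m!\<close>; all others have absolute value 1.\<close>

lemma vabs_fact_mult: "vabs (fact (p * m) :: 'a) = (1 / real p) ^ m * vabs (fact m :: 'a)"
proof (induction m)
  case (Suc m)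
  have *: "vabs (fact (p * m + (p - 1)) :: 'a) = vabs (fact (p * m) :: 'a)"
    using p_gt_1 by (intro vabs_fact_mult_add) simp
  have "p * Suc m = Suc (p * m + (p - 1))"
    using p_gt_1 by simp
  then have "fact (p * Suc m) = (of_nat p * of_nat (Suc m) * fact (p * m + (p - 1)) :: 'a)"
    by (metis fact_Suc of_nat_mult)
  then have "vabs (fact (p * Suc m) :: 'a) =
      1 / real p * vabs (of_nat (Suc m) :: 'a) * vabs (fact (p * m) :: 'a)"
    by (simp only: vabs_mult vabs_p *)
  then show ?case
    by (simp add: Suc vabs_mult del: of_nat_Suc)
qed simp

text \<open>Legendre's formula gives \<open>v\<^sub>p(n!) \<le> (n - 1) / (p - 1)\<close> for \<open>n \<ge> 1\<close>.\<close>

lemma vabs_fact_ge: "r ^ (n - 1) \<le> vabs (fact n :: 'a)"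
proof (induction n rule: less_induct)
  case (less n)
  define m where "m = n div p"
  have n: "vabs (fact n :: 'a) = (1 / real p) ^ m * vabs (fact m :: 'a)"
    using vabs_fact_mult_add[of "n mod p" m] p_gt_1 by (simp add: m_def vabs_fact_mult)
  show ?case
  proof (cases "m = 0")
    case True
    then show ?thesis
      using n r_less_1 by (simp add: power_le_one)
  next
    case False
    have "p * m \<le> n"
      by (simp add: m_def)
    have "m < n"
    proof -
      have "n > 0"
        using False by (cases "n = 0") (auto simp: m_def)
      then show ?thesis
        using p_gt_1 by (simp add: m_def)
    qed
    \<comment> \<open>The exponent equals \<open>p m - 1\<close>. Its first part yields the factor
      \<open>(1 / p)^m\<close>, its second the induction hypothesis for \<open>m!\<close>.\<close>
    have "r ^ (n - 1) \<le> r ^ ((p - 1) * m + (m - 1))"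
    proof (rule power_decreasing)
      have "(p - 1) * m + (m - 1) = p * m - 1"
        using False p_gt_1 by (cases p; cases m) auto
      then show "(p - 1) * m + (m - 1) \<le> n - 1"
        using \<open>p * m \<le> n\<close> by simp
    qed (use r_less_1 in auto)
    also have "\<dots> = (1 / real p) ^ m * r ^ (m - 1)"
      by (simp only: power_add power_mult r_power)
    also have "\<dots> \<le> vabs (fact n :: 'a)"
      unfolding n using less.IH[OF \<open>m < n\<close>] by (intro mult_left_mono) auto
    finally show ?thesis .
  qed
qed

text \<open>As \<open>n! = n (n-1)!\<close> and \<open>(n-1)!\<close> has absolute value at most 1,
  the factorial bound passes to \<open>n\<close>. The logarithm thereby converges on the same
  disc.\<close>

lemma vabs_of_nat_ge_power:
  assumes "n > 0"
  shows "r ^ (n - 1) \<le> vabs (of_nat n :: 'a)"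
proof -
  have "r ^ (n - 1) \<le> vabs (fact n :: 'a)"
    by (rule vabs_fact_ge)
  also have "fact n = (of_nat n * fact (n - 1) :: 'a)"
    using assms by (simp add: fact_reduce)
  also have "vabs \<dots> \<le> vabs (of_nat n :: 'a) * 1"
    unfolding vabs_mult using vabs_of_nat_le_1[of "fact (n - 1)"]
    by (intro mult_left_mono) (simp_all add: of_nat_fact)
  finally show ?thesis by simp
qed

section \<open>Exponential, logarithm and binomial series\<close>

lemma null_geometric_div:
  fixes s :: real
  assumes "0 \<le> s" "s < r"
  shows "(\<lambda>n. s ^ n / r ^ (n - 1)) \<longlonglongrightarrow> 0"
proof -
  have "(\<lambda>n. s * (s / r) ^ n) \<longlonglongrightarrow> s * 0"
    using assms by (intro tendsto_mult_left LIMSEQ_power_zero) simp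
  then have "(\<lambda>n. s ^ Suc n / r ^ (Suc n - 1)) \<longlonglongrightarrow> 0"
    by (simp add: power_divide)
  then show ?thesis
    by (rule LIMSEQ_imp_Suc)
qed

text \<open>The bound \<open>c\<close> holds both for \<open>1 / n!\<close> and for the logarithm's
  coefficients; only the constant coefficient is left free.\<close>

context
  fixes c :: "nat \<Rightarrow> 'a" and z :: 'a
  assumes c: "\<And>n. n > 0 \<Longrightarrow> vabs (c n) \<le> 1 / r ^ (n - 1)" and z: "vabs z < r"
begin

lemma exp_type_term_le: "n > 0 \<Longrightarrow> vabs (c n * z ^ n) \<le> vabs z ^ n / r ^ (n - 1)"
  using mult_right_mono[OF c, of n "vabs z ^ n"] by (simp add: vabs_mult vabs_power)

lemma exp_type_summable: "summable (\<lambda>n. c n * z ^ n)"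
proof (rule summable_null)
  have "(\<lambda>n. vabs (c n * z ^ n)) \<longlonglongrightarrow> 0"
  proof (rule tendsto_sandwich[OF _ _ tendsto_const])
    show "(\<lambda>n. vabs z ^ n / r ^ (n - 1)) \<longlonglongrightarrow> 0"
      using z by (intro null_geometric_div) auto
    show "\<forall>\<^sub>F n in sequentially. vabs (c n * z ^ n) \<le> vabs z ^ n / r ^ (n - 1)"
      using eventually_gt_at_top[of 0] by eventually_elim (rule exp_type_term_le)
  qed simp
  then show "(\<lambda>n. c n * z ^ n) \<longlonglongrightarrow> 0"
    by (simp add: tendsto_zero_vabs_iff)
qed

text \<open>The terms from degree 2 on are at most \<open>vabs z * (vabs z / r)\<close>, strictly
  below \<open>vabs z\<close> unless \<open>z = 0\<close>.\<close>

lemma exp_type_minus_le: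
  assumes "(\<lambda>n. c n * z ^ n) sums s"
  shows "vabs (s - c 0 - c 1 * z) \<le> vabs z * (vabs z / r)"
proof -
  have "vabs (s - (\<Sum>n<2. c n * z ^ n)) \<le> vabs z * (vabs z / r)"
  proof (rule vabs_tail_le[OF assms])
    fix n :: nat assume "2 \<le> n"
    then have "vabs (c n * z ^ n) \<le> vabs z ^ n / r ^ (n - 1)"
      by (intro exp_type_term_le) simp
    also have "\<dots> = vabs z * (vabs z / r) ^ (n - 1)"
      using \<open>2 \<le> n\<close> by (cases n) (simp_all add: power_divide)
    also have "\<dots> \<le> vabs z * (vabs z / r) ^ 1"
      using z \<open>2 \<le> n\<close> by (intro mult_left_mono power_decreasing) auto
    finally show "vabs (c n * z ^ n) \<le> vabs z * (vabs z / r)" by simp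
  qed
  then show ?thesis
    by (simp add: numeral_2_eq_2 diff_diff_eq)
qed

end

lemma padic_exp_sums:
  assumes "vabs (z :: 'a) < r"
  shows "(\<lambda>n. z ^ n / fact n) sums padic_exp z"
proof -
  have "summable (\<lambda>n. 1 / fact n * z ^ n)"
    by (rule exp_type_summable[OF _ assms])
      (use vabs_fact_ge in \<open>auto simp: vabs_divide intro!: divide_left_mono\<close>)
  then show ?thesis
    by (simp add: padic_exp_def summable_sums)
qed

lemma vabs_padic_exp_minus_1:
  assumes "vabs (z :: 'a) < r"
  shows "vabs (padic_exp z - 1) = vabs z"
proof (cases "z = 0")
  case True
  have "(\<lambda>n. 0 ^ n / fact n :: 'a) sums (0 ^ 0 / fact 0)"
    using sums_single[of 0 "\<lambda>n. 0 ^ n / fact n :: 'a"]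
    by (rule sums_cong[THEN iffD1, rotated]) auto
  then show ?thesis
    using True padic_exp_sums[OF assms] by (auto dest: sums_unique2)
next
  case False
  have "vabs (padic_exp z - 1 / fact 0 - 1 / fact 1 * z) \<le> vabs z * (vabs z / r)"
    by (rule exp_type_minus_le[OF _ assms])
      (use vabs_fact_ge padic_exp_sums[OF assms] in \<open>auto simp: vabs_divide intro!: divide_left_mono\<close>)
  also have "\<dots> < vabs z * 1"
    using False assms by (intro mult_strict_left_mono) auto
  finally have "vabs (z + (padic_exp z - 1 - z)) = vabs z"
    by (intro vabs_add_eq_left) simp
  then show ?thesis by simp
qed

text \<open>The coefficients of the Cauchy product are read off from the law
  \<open>fps_exp_add_mult\<close> for formal series.\<close>

lemma padic_exp_add:
  assumes "vabs (z :: 'a) < r" "vabs w < r"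
  shows "padic_exp (z + w) = padic_exp z * padic_exp w"
proof -
  have "(\<lambda>n. \<Sum>k\<le>n. z ^ k / fact k * (w ^ (n - k) / fact (n - k))) sums (padic_exp z * padic_exp w)"
    using assms by (intro Cauchy_product_nonarch padic_exp_sums)
  moreover have "(\<Sum>k\<le>n. z ^ k / fact k * (w ^ (n - k) / fact (n - k))) = (z + w) ^ n / fact n" for n
    using arg_cong[OF fps_exp_add_mult[of z w], of "\<lambda>F. F $ n"]
    by (simp add: fps_mult_nth atLeast0AtMost)
  moreover have "vabs (z + w) < r"
    using vabs_ultrametric[of z w] assms by simp
  then have "(\<lambda>n. (z + w) ^ n / fact n) sums padic_exp (z + w)"
    by (rule padic_exp_sums)
  ultimately show ?thesis
    by (simp add: sums_unique2)
qed

lemma fps_ln_sums: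
  assumes "vabs (z :: 'a) < r"
  shows "(\<lambda>n. fps_ln 1 $ n * z ^ n) sums padic_log (1 + z)"
proof -
  have *: "vabs (fps_ln 1 $ n :: 'a) \<le> 1 / r ^ (n - 1)" if "n > 0" for n
    using that vabs_of_nat_ge_power[OF that]
    by (auto simp: fps_ln_nth vabs_divide vabs_power intro!: divide_left_mono)
  have "summable (\<lambda>n. fps_ln 1 $ n * z ^ n)"
    by (rule exp_type_summable[OF * assms])
  then obtain s where s: "(\<lambda>n. fps_ln 1 $ n * z ^ n) sums s"
    by (auto simp: summable_def)
  \<comment> \<open>The formal logarithm has constant term 0, so dropping it shifts the index by one
    without changing the sum.\<close>
  have "(\<lambda>n. (- 1) ^ n * z ^ Suc n / of_nat (Suc n)) sums s"
    using s unfolding sums_def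
    by (subst (asm) filterlim_sequentially_Suc[symmetric])
      (simp add: sum.lessThan_Suc_shift fps_ln_nth del: of_nat_Suc sum.lessThan_Suc)
  then have "padic_log (1 + z) = s"
    by (simp add: padic_log_def sums_iff del: of_nat_Suc)
  with s show ?thesis by simp
qed

lemma vabs_padic_log_le:
  assumes "vabs (z :: 'a) < r"
  shows "vabs (padic_log (1 + z)) \<le> vabs z"
proof (rule vabs_sums_le[OF fps_ln_sums[OF assms]])
  fix n
  show "vabs (fps_ln 1 $ n * z ^ n) \<le> vabs z"
  proof (cases n)
    case (Suc m)
    have "vabs (fps_ln 1 $ n * z ^ n) \<le> vabs z ^ n / r ^ m"
      using vabs_of_nat_ge_power[of n]
      by (auto simp: Suc fps_ln_nth vabs_divide vabs_power vabs_mult simp del: of_nat_Suc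
          intro!: divide_left_mono)
    also have "\<dots> = vabs z * (vabs z / r) ^ m"
      by (simp add: Suc power_divide)
    also have "\<dots> \<le> vabs z * 1"
      using assms by (intro mult_left_mono power_le_one) auto
    finally show ?thesis by simp
  qed simp
qed

lemma fps_ln_power_sums:
  assumes "vabs (z :: 'a) < r"
  shows "(\<lambda>n. (fps_ln 1 ^ k) $ n * z ^ n) sums (padic_log (1 + z) ^ k)"
proof (induction k)
  case 0
  have "(\<lambda>n. (fps_ln 1 ^ 0) $ n * z ^ n) = (\<lambda>n. if n = 0 then 1 else 0)"
    by (auto simp: fun_eq_iff)
  then show ?case
    using sums_single[of 0 "\<lambda>n. 1 :: 'a"] by simp
next
  case (Suc k)
  have "(\<Sum>i\<le>n. fps_ln 1 $ i * z ^ i * ((fps_ln 1 ^ k) $ (n - i) * z ^ (n - i))) =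
      (fps_ln 1 ^ Suc k) $ n * z ^ n" for n
    unfolding power_Suc fps_mult_nth atLeast0AtMost sum_distrib_right
    by (intro sum.cong) (auto simp: mult_ac simp flip: power_add)
  then show ?case
    using Cauchy_product_nonarch[OF fps_ln_sums[OF assms] Suc] by simp
qed

text \<open>Expanding the powers of \<open>log (1 + z)\<close> in the exponential series and exchanging the sums
  leaves the Stirling expansion of the falling factorials of \<open>c\<close>.\<close>

lemma padic_binomial_series:
  assumes z: "vabs (z :: 'a) < r" and cz: "vabs (c * z) < r"
  shows "(\<lambda>n. falling_fact c n * z ^ n / fact n) sums padic_exp (c * padic_log (1 + z))"
proof -
  define T where "T k n = of_int (stirling1 n k) * c ^ k * z ^ n / fact n" for k n
  \<comment> \<open>The scalar \<open>c\<close> may be large. For \<open>vabs c \<le> 1\<close> the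
    factor \<open>c ^ k\<close> is harmless; otherwise it is enlarged to \<open>c ^ n\<close> and
    absorbed into \<open>(c * z) ^ n\<close>. So \<open>m\<close> serves all
    \<open>k \<le> n\<close>.\<close>
  define m where "m = max (vabs z) (vabs (c * z))"
  have m: "0 \<le> m" "m < r"
    using z cz by (auto simp: m_def max_def)
  have "(\<lambda>n. \<Sum>k\<le>n. T k n) sums padic_exp (c * padic_log (1 + z))"
  proof (rule triangular_double_sum)
    show "T k n = 0" if "n < k" for k n
      using that by (simp add: T_def stirling1_eq_0)
    show "T k sums ((c * padic_log (1 + z)) ^ k / fact k)" for k
      using sums_cmult[OF fps_ln_power_sums[OF z, of k], of "c ^ k / fact k"]
      by (simp add: T_def[abs_def] fps_ln_power_nth power_mult_distrib mult_ac)
    have "vabs (c * padic_log (1 + z)) \<le> vabs (c * z)"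
      unfolding vabs_mult using vabs_padic_log_le[OF z] by (intro mult_left_mono) auto
    then show "(\<lambda>k. (c * padic_log (1 + z)) ^ k / fact k) sums padic_exp (c * padic_log (1 + z))"
      using cz by (intro padic_exp_sums) simp
    have T: "vabs (T k n) \<le> m ^ n / r ^ (n - 1)" if "k \<le> n" for k n
    proof -
      have "vabs (c ^ k * z ^ n) \<le> m ^ n"
      proof (cases "vabs c \<le> 1")
        case True
        have "vabs (c ^ k * z ^ n) \<le> 1 * vabs z ^ n"
          unfolding vabs_mult vabs_power using True by (intro mult_right_mono power_le_one) auto
        also have "\<dots> \<le> m ^ n"
          by (simp add: m_def power_mono)
        finally show ?thesis .
      next
        case False
        have "vabs (c ^ k * z ^ n) \<le> vabs c ^ n * vabs z ^ n"
          unfolding vabs_mult vabs_power using False that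
          by (intro mult_right_mono power_increasing) auto
        also have "\<dots> = vabs (c * z) ^ n"
          by (simp add: vabs_mult power_mult_distrib)
        also have "\<dots> \<le> m ^ n"
          by (intro power_mono) (auto simp: m_def)
        finally show ?thesis .
      qed
      then have "vabs (of_int (stirling1 n k) :: 'a) * vabs (c ^ k * z ^ n) \<le> 1 * m ^ n"
        by (intro mult_mono) auto
      then have "vabs (of_int (stirling1 n k) :: 'a) * vabs (c ^ k * z ^ n) / vabs (fact n :: 'a)
          \<le> m ^ n / r ^ (n - 1)"
        using vabs_fact_ge[of n] m by (intro frac_le) auto
      then show ?thesis
        by (simp add: T_def vabs_mult vabs_divide mult.assoc)
    qed
    fix e :: real assume "e > 0"
    then have "\<forall>\<^sub>F n in sequentially. m ^ n / r ^ (n - 1) < e"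
      using null_geometric_div[OF m] by (intro order_tendstoD)
    then show "\<exists>M. \<forall>n\<ge>M. \<forall>k\<le>n. vabs (T k n) \<le> e"
      unfolding eventually_sequentially by (meson T le_less_trans less_imp_le)
  qed
  moreover have "(\<Sum>k\<le>n. T k n) = falling_fact c n * z ^ n / fact n" for n
    by (simp add: T_def falling_fact_conv_stirling1 sum_distrib_right sum_divide_distrib)
  ultimately show ?thesis by simp
qed

text \<open>The binomial series with exponent 1 stops after its linear term.\<close>

lemma padic_exp_log:
  assumes "vabs (z :: 'a) < r"
  shows "padic_exp (padic_log (1 + z)) = 1 + z"
proof -
  have "falling_fact (1::'a) n = 0" if "n \<ge> 2" for n
    unfolding falling_fact_def using that by (intro prod_zero) (auto intro!: bexI[of _ 1])
  then have "(\<lambda>n. falling_fact 1 n * z ^ n / fact n) sums (\<Sum>n<2. falling_fact 1 n * z ^ n / fact n)"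
    by (intro sums_finite) auto
  moreover have "(\<Sum>n<2. falling_fact 1 n * z ^ n / fact n) = 1 + z"
    by (simp add: numeral_2_eq_2 falling_fact_Suc)
  moreover have "(\<lambda>n. falling_fact 1 n * z ^ n / fact n) sums padic_exp (1 * padic_log (1 + z))"
    using assms by (intro padic_binomial_series) auto
  ultimately show ?thesis
    by (metis mult_1 sums_unique2)
qed

text \<open>\<open>padic_exp\<close> preserves the distance to its value at 0, and applied to the
  logarithm it returns \<open>1 + z\<close>.\<close>

lemma vabs_padic_log:
  assumes "vabs (z :: 'a) < r"
  shows "vabs (padic_log (1 + z)) = vabs z"
  using vabs_padic_exp_minus_1[of "padic_log (1 + z)"] vabs_padic_log_le[OF assms] assms
  by (simp add: padic_exp_log)

end

section \<open>Moments of the \<open>q\<close>-integral\<close>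

locale padic_q = padic_field p ty for p and ty :: "'a::{nonarch_field, complete_space} itself" +
  fixes q :: 'a
  assumes q: "vabs (q - 1) < r"
begin

section \<open>Powers of \<open>q\<close>, \<open>q\<close>-numbers and Riemann sums\<close>

lemma vabs_log_q: "vabs (padic_log q) = vabs (q - 1)"
  using vabs_padic_log[OF q] by simp

lemma vabs_mult_log_q:
  assumes "vabs x \<le> 1"
  shows "vabs (x * padic_log q) < r"
proof -
  have "vabs (x * padic_log q) \<le> 1 * vabs (q - 1)"
    unfolding vabs_mult vabs_log_q using assms by (intro mult_right_mono) auto
  then show ?thesis
    using q by simp
qed

lemma vabs_qpow_minus_1: "vabs x \<le> 1 \<Longrightarrow> vabs (qpow q x - 1) = vabs x * vabs (q - 1)"
  using vabs_padic_exp_minus_1[OF vabs_mult_log_q[of x]]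
  by (simp add: qpow_def vabs_mult vabs_log_q)

lemma qpow_add: "vabs x \<le> 1 \<Longrightarrow> vabs y \<le> 1 \<Longrightarrow> qpow q (x + y) = qpow q x * qpow q y"
  unfolding qpow_def distrib_right by (intro padic_exp_add vabs_mult_log_q)

lemma qpow_0 [simp]: "qpow q 0 = 1"
  using vabs_qpow_minus_1[of 0] by simp

lemma qpow_1 [simp]: "qpow q 1 = q"
  using padic_exp_log[OF q] by (simp add: qpow_def)

text \<open>For \<open>q = 1\<close> the power is 1 by \<open>vabs_qpow_minus_1\<close>, so the
  formula also fits the limit convention in \<open>qnum\<close>.\<close>

lemma qpow_conv_qnum: "vabs x \<le> 1 \<Longrightarrow> qpow q x = 1 + (q - 1) * qnum q x"
  using vabs_qpow_minus_1[of x] by (auto simp: qnum_def field_simps)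

lemma vabs_qpow_le_1: "vabs x \<le> 1 \<Longrightarrow> vabs (qpow q x) \<le> 1"
proof -
  assume x: "vabs x \<le> 1"
  then have "vabs (qpow q x - 1) \<le> 1 * 1"
    unfolding vabs_qpow_minus_1[OF x] using q r_less_1 by (intro mult_mono) auto
  then show ?thesis
    using vabs_add_le[of "qpow q x - 1" 1 1] by simp
qed

lemma qnum_0 [simp]: "qnum q 0 = 0"
  by (simp add: qnum_def)

lemma qnum_1 [simp]: "qnum q 1 = 1"
  by (simp add: qnum_def)

lemma qnum_add:
  assumes "vabs x \<le> 1" "vabs y \<le> 1"
  shows "qnum q (x + y) = qnum q x + qpow q x * qnum q y"
proof (cases "q = 1")
  case True
  then show ?thesis
    using qpow_conv_qnum[OF assms(1)] by (simp add: qnum_def)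
next
  case False
  then show ?thesis
    by (simp add: qnum_def qpow_add assms divide_simps) (simp add: algebra_simps)
qed

text \<open>The factor \<open>vabs (q - 1)\<close> of \<open>vabs (qpow q x - 1)\<close> cancels.
  Hence \<open>h N\<close> is null, and \<open>q\<close>-numbers of positive integers are
  nonzero.\<close>

lemma vabs_qnum:
  assumes "vabs x \<le> 1"
  shows "vabs (qnum q x) = vabs x"
  using vabs_qpow_minus_1[OF assms] vabs_minus_commute[of 1 q] vabs_minus_commute[of 1 "qpow q x"]
  by (auto simp: qnum_def vabs_divide)

lemma vabs_qnum_le_1: "vabs x \<le> 1 \<Longrightarrow> vabs (qnum q x) \<le> 1"
  by (simp add: vabs_qnum)

lemma qnum_of_nat_neq_0: "n > 0 \<Longrightarrow> qnum q (of_nat n) \<noteq> 0"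
  using vabs_qnum[of "of_nat n"] by (metis neq0_conv of_nat_eq_0_iff vabs_eq_0_iff vabs_of_nat_le_1)

abbreviation h :: "nat \<Rightarrow> 'a" where
  "h N \<equiv> qnum q (of_nat (p ^ N))"

lemma h_neq_0: "h N \<noteq> 0"
  using p_gt_1 by (intro qnum_of_nat_neq_0) simp

lemma h_tendsto_0: "h \<longlonglongrightarrow> 0"
proof -
  have "vabs (h N) = (1 / real p) ^ N" for N
    using vabs_qnum[OF vabs_of_nat_le_1[of "p ^ N"]]
    by (simp add: vabs_power vabs_p)
  moreover have "(\<lambda>N. (1 / real p) ^ N) \<longlonglongrightarrow> 0"
    using p_gt_1 by (intro LIMSEQ_power_zero) simp
  ultimately show ?thesis
    unfolding tendsto_zero_vabs_iff by simp
qed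

text \<open>Riemann sums sample the integrand at natural numbers only, so \<open>g\<close> is a
  function on \<open>nat\<close>.\<close>

definition moment :: "nat \<Rightarrow> (nat \<Rightarrow> 'a) \<Rightarrow> 'a" where
  "moment N g = (\<Sum>y<p ^ N. g y * qpow q (of_nat y)) / h N"

lemma padic_q_integral_conv_moment:
  "padic_q_integral p q f = lim (\<lambda>N. moment N (\<lambda>y. f (of_nat y)))"
  by (simp add: padic_q_integral_def moment_def)

lemma moment_sum: "moment N (\<lambda>y. \<Sum>k\<in>A. c k * g k y) = (\<Sum>k\<in>A. c k * moment N (g k))"
proof -
  have "(\<Sum>y<p ^ N. (\<Sum>k\<in>A. c k * g k y) * qpow q (of_nat y)) =
      (\<Sum>k\<in>A. \<Sum>y<p ^ N. c k * g k y * qpow q (of_nat y))"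
    unfolding sum_distrib_right by (rule sum.swap)
  then show ?thesis
    by (simp add: moment_def sum_divide_distrib sum_distrib_left mult.assoc)
qed

lemma moment_sums:
  assumes "\<And>y. (\<lambda>n. g n y) sums f y"
  shows "(\<lambda>n. moment N (g n)) sums moment N f"
proof -
  have "(\<lambda>n. \<Sum>y<p ^ N. qpow q (of_nat y) * g n y) sums (\<Sum>y<p ^ N. qpow q (of_nat y) * f y)"
    using assms by (intro sums_sum sums_cmult)
  from sums_cmult[OF this, of "1 / h N"] show ?thesis
    by (simp add: moment_def mult.commute)
qed

section \<open>The \<open>q\<close>-Newton basis and its moments\<close>

definition newton :: "nat \<Rightarrow> nat \<Rightarrow> 'a" where
  "newton k y = (\<Prod>i<k. qnum q (of_nat y) - qnum q (of_nat i))"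

lemma newton_Suc: "newton (Suc k) y = newton k y * (qnum q (of_nat y) - qnum q (of_nat k))"
  by (simp add: newton_def)

lemma qnum_of_nat_Suc: "qnum q (of_nat (Suc y)) = 1 + q * qnum q (of_nat y)"
  using qnum_add[of 1 "of_nat y"] by simp

lemma qpow_of_nat: "qpow q (of_nat k) = q ^ k"
proof (induction k)
  case (Suc k)
  then show ?case
    using qpow_add[of 1 "of_nat k"] by simp
qed simp

text \<open>Raising both arguments by one multiplies a difference of \<open>q\<close>-numbers by
  \<open>q\<close>; the factor for \<open>i = 0\<close> is split off.\<close>

lemma newton_Suc_Suc: "newton (Suc k) (Suc y) = qnum q (of_nat (Suc y)) * q ^ k * newton k y"
proof -
  have "newton (Suc k) (Suc y) = qnum q (of_nat (Suc y)) *
      (\<Prod>i<k. qnum q (of_nat (Suc y)) - qnum q (of_nat (Suc i)))"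
    by (simp add: newton_def prod.lessThan_Suc_shift del: prod.lessThan_Suc of_nat_Suc)
  also have "(\<Prod>i<k. qnum q (of_nat (Suc y)) - qnum q (of_nat (Suc i))) =
      (\<Prod>i<k. q * (qnum q (of_nat y) - qnum q (of_nat i)))"
    by (intro prod.cong refl) (simp only: qnum_of_nat_Suc, simp add: algebra_simps)
  finally show ?thesis
    by (simp add: newton_def prod.distrib del: of_nat_Suc)
qed

text \<open>Up to a factor not depending on \<open>y\<close>, \<open>newton k y\<close> is the \<open>q\<close>-binomial coefficient of
  \<open>y\<close> over \<open>k\<close>, so this is the \<open>q\<close>-analogue of the hockey-stick identity.\<close>

lemma sum_newton:
  "qnum q (of_nat (Suc k)) * (\<Sum>y<m. newton k y * qpow q (of_nat y)) = newton (Suc k) m"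
proof (induction m)
  case 0
  show ?case by (simp add: newton_def prod.lessThan_Suc_shift del: prod.lessThan_Suc)
next
  case (Suc m)
  \<comment> \<open>Both sides are the \<open>q\<close>-number of \<open>k + m + 1\<close>, split as
    \<open>k + (m + 1)\<close> and as \<open>m + (k + 1)\<close>.\<close>
  have "qnum q (of_nat k) + q ^ k * qnum q (of_nat (Suc m)) =
      qnum q (of_nat m) + qpow q (of_nat m) * qnum q (of_nat (Suc k))"
    using qnum_add[of "of_nat k" "of_nat (Suc m)"] qnum_add[of "of_nat m" "of_nat (Suc k)"]
      vabs_of_nat_le_1[of "Suc m"] vabs_of_nat_le_1[of "Suc k"]
    by (simp only: qpow_of_nat[symmetric] vabs_of_nat_le_1 of_nat_add[symmetric] add_Suc_right
        add.commute[of m k])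
  then have "qnum q (of_nat (Suc m)) * q ^ k =
      qnum q (of_nat m) + qpow q (of_nat m) * qnum q (of_nat (Suc k)) - qnum q (of_nat k)"
    by (simp add: algebra_simps del: of_nat_Suc)
  then show ?case
    unfolding sum.lessThan_Suc distrib_left Suc newton_Suc_Suc
    by (simp only: newton_Suc) (simp add: algebra_simps del: of_nat_Suc)
qed

text \<open>The factor of \<open>newton (Suc k) (p ^ N)\<close> for \<open>i = 0\<close> is
  \<open>h N\<close> itself and cancels the normalisation. What remains is a polynomial in
  \<open>h N\<close>, whose limit is clear.\<close>

lemma moment_newton:
  "moment N (newton k) = (\<Prod>i<k. h N - qnum q (of_nat (Suc i))) / qnum q (of_nat (Suc k))"
proof -
  have "qnum q (of_nat (Suc k)) * (\<Sum>y<p ^ N. newton k y * qpow q (of_nat y)) =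
      h N * (\<Prod>i<k. h N - qnum q (of_nat (Suc i)))"
    unfolding sum_newton by (simp add: newton_def prod.lessThan_Suc_shift del: prod.lessThan_Suc of_nat_Suc)
  then show ?thesis
    using h_neq_0[of N] qnum_of_nat_neq_0[of "Suc k"]
    by (simp add: moment_def divide_simps mult_ac del: of_nat_Suc)
qed

lemma vabs_moment_newton_le: "vabs (moment N (newton k)) \<le> real (Suc k)"
proof -
  have "1 / real (Suc k) \<le> vabs (qnum q (of_nat (Suc k)))"
    using vabs_of_nat_ge[of "Suc k"] by (simp add: vabs_qnum del: of_nat_Suc)
  moreover have "vabs (\<Prod>i<k. h N - qnum q (of_nat (Suc i))) \<le> 1"
    by (intro vabs_prod_le_1 vabs_diff_le vabs_qnum_le_1 vabs_of_nat_le_1)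
  ultimately have "vabs (moment N (newton k)) \<le> 1 / (1 / real (Suc k))"
    unfolding moment_newton vabs_divide by (intro frac_le) auto
  then show ?thesis by simp
qed

lemma moment_newton_tendsto:
  "(\<lambda>N. moment N (newton k)) \<longlonglongrightarrow>
    (\<Prod>i<k. 0 - qnum q (of_nat (Suc i))) / qnum q (of_nat (Suc k))"
  unfolding moment_newton divide_inverse
  by (rule tendsto_mult[OF tendsto_prod' tendsto_const])
    (rule tendsto_diff[OF h_tendsto_0 tendsto_const])

section \<open>The generating function\<close>

definition shifted :: "'a \<Rightarrow> 'a \<Rightarrow> nat \<Rightarrow> nat \<Rightarrow> 'a" where
  "shifted lam x n y = (\<Prod>i<n. qnum q (x + of_nat y) - of_nat i * lam)"

definition beta :: "'a \<Rightarrow> 'a \<Rightarrow> nat \<Rightarrow> 'a" where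
  "beta lam x n = lim (\<lambda>N. moment N (shifted lam x n))"

context
  fixes lam x :: 'a
  assumes x: "vabs x \<le> 1"
begin

text \<open>The bound is geometric in \<open>n\<close>, as dominated convergence will require.
  Vanishing beyond \<open>n\<close> is carried along so that the extra top term drops in the
  induction.\<close>

lemma shifted_newton_expansion:
  "\<exists>c. (\<forall>y. shifted lam x n y = (\<Sum>k\<le>n. c k * newton k y)) \<and>
       (\<forall>k>n. c k = 0) \<and> (\<forall>k. vabs (c k) \<le> max 1 (vabs lam) ^ n)"
proof (induction n)
  case 0
  show ?case
    by (intro exI[of _ "\<lambda>k. if k = 0 then 1 else 0"]) (simp add: shifted_def newton_def)
next
  case (Suc n)
  let ?R = "max 1 (vabs lam)"
  from Suc obtain c where c: "\<And>y. shifted lam x n y = (\<Sum>k\<le>n. c k * newton k y)"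
    and c0: "\<And>k. k > n \<Longrightarrow> c k = 0" and cR: "\<And>k. vabs (c k) \<le> ?R ^ n"
    by blast
  \<comment> \<open>The new factor is \<open>[x] - n lam + q^x [y]\<close>, and \<open>[y]\<close>
    times \<open>newton k y\<close> equals \<open>newton (Suc k) y + [k] newton k y\<close>.\<close>
  define d where "d k = (qnum q x - of_nat n * lam + qpow q x * qnum q (of_nat k)) * c k +
    (case k of 0 \<Rightarrow> 0 | Suc j \<Rightarrow> qpow q x * c j)" for k
  have mult_le: "vabs (u * v) \<le> ?R" if "vabs u \<le> 1" "vabs v \<le> ?R" for u v :: 'a
    using mult_mono[OF that] by (simp add: vabs_mult)
  have coeff: "vabs (qnum q x - of_nat n * lam + qpow q x * qnum q (of_nat k)) \<le> ?R" for k
    using x by (intro vabs_add_le vabs_diff_le mult_le vabs_of_nat_le_1 vabs_qpow_le_1)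
      (auto intro: order_trans[OF vabs_qnum_le_1])
  have "vabs (d k) \<le> ?R * ?R ^ n" for k
    unfolding d_def
  proof (rule vabs_add_le)
    show "vabs ((qnum q x - of_nat n * lam + qpow q x * qnum q (of_nat k)) * c k) \<le> ?R * ?R ^ n"
      unfolding vabs_mult[of _ "c k"] using coeff cR by (intro mult_mono) auto
    show "vabs (case k of 0 \<Rightarrow> 0 | Suc j \<Rightarrow> qpow q x * c j) \<le> ?R * ?R ^ n"
    proof (cases k)
      case (Suc j)
      have "vabs (qpow q x * c j) \<le> ?R * ?R ^ n"
        unfolding vabs_mult using cR vabs_qpow_le_1[OF x] by (intro mult_mono) auto
      then show ?thesis by (simp add: Suc)
    qed (auto intro: order_trans[of 0 1])
  qed
  moreover have "d k = 0" if "k > Suc n" for k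
    using that by (auto simp: d_def c0 split: nat.split)
  moreover have "shifted lam x (Suc n) y = (\<Sum>k\<le>Suc n. d k * newton k y)" for y
  proof -
    have "(\<Sum>k\<le>Suc n. d k * newton k y) =
        (\<Sum>k\<le>Suc n. (qnum q x - of_nat n * lam + qpow q x * qnum q (of_nat k)) * c k * newton k y) +
        (\<Sum>k\<le>Suc n. (case k of 0 \<Rightarrow> 0 | Suc j \<Rightarrow> qpow q x * c j) * newton k y)"
      by (simp only: d_def distrib_right sum.distrib)
    also have "(\<Sum>k\<le>Suc n. (case k of 0 \<Rightarrow> 0 | Suc j \<Rightarrow> qpow q x * c j) * newton k y) =
        (\<Sum>k\<le>n. qpow q x * c k * newton (Suc k) y)"
      by (subst sum.atMost_Suc_shift) simp
    also have "(\<Sum>k\<le>Suc n. (qnum q x - of_nat n * lam + qpow q x * qnum q (of_nat k)) * c k * newton k y) =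
        (\<Sum>k\<le>n. (qnum q x - of_nat n * lam + qpow q x * qnum q (of_nat k)) * c k * newton k y)"
      by (simp add: c0)
    also have "\<dots> + (\<Sum>k\<le>n. qpow q x * c k * newton (Suc k) y) =
        (\<Sum>k\<le>n. c k * newton k y * (qnum q x + qpow q x * qnum q (of_nat y) - of_nat n * lam))"
      unfolding sum.distrib[symmetric] newton_Suc by (intro sum.cong refl) (simp add: algebra_simps)
    also have "\<dots> = shifted lam x n y * (qnum q (x + of_nat y) - of_nat n * lam)"
      unfolding c sum_distrib_right qnum_add[OF x vabs_of_nat_le_1] ..
    also have "\<dots> = shifted lam x (Suc n) y"
      by (simp add: shifted_def)
    finally show ?thesis ..
  qed
  ultimately show ?case
    by (intro exI[of _ d]) simp
qed

lemma moment_shifted_convergent: "convergent (\<lambda>N. moment N (shifted lam x n))"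
  and vabs_moment_shifted_le: "vabs (moment N (shifted lam x n)) \<le> max 1 (vabs lam) ^ n * real (Suc n)"
proof -
  let ?R = "max 1 (vabs lam)"
  obtain c where c: "\<And>y. shifted lam x n y = (\<Sum>k\<le>n. c k * newton k y)"
    and cR: "\<And>k. vabs (c k) \<le> ?R ^ n"
    using shifted_newton_expansion[of n] by blast
  have *: "moment N (shifted lam x n) = (\<Sum>k\<le>n. c k * moment N (newton k))" for N
    unfolding moment_sum[symmetric] using c by (simp add: moment_def)
  show "convergent (\<lambda>N. moment N (shifted lam x n))"
    unfolding * by (rule convergentI, rule tendsto_sum, rule tendsto_mult_left, rule moment_newton_tendsto)
  show "vabs (moment N (shifted lam x n)) \<le> ?R ^ n * real (Suc n)"
    unfolding *
  proof (rule vabs_sum_le)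
    fix k assume "k \<in> {..n}"
    have "vabs (moment N (newton k)) \<le> real (Suc n)"
      using vabs_moment_newton_le[of N k] \<open>k \<in> {..n}\<close> by simp
    then show "vabs (c k * moment N (newton k)) \<le> ?R ^ n * real (Suc n)"
      unfolding vabs_mult using cR[of k] by (intro mult_mono) auto
  qed simp
qed

lemma moment_shifted_tendsto: "(\<lambda>N. moment N (shifted lam x n)) \<longlonglongrightarrow> beta lam x n"
  using moment_shifted_convergent by (simp add: beta_def convergent_LIMSEQ_iff)

text \<open>Binomial series with \<open>c = a / lam\<close> and \<open>z = lam * t\<close>. Since
  \<open>a\<close> has absolute value at most 1, the condition on \<open>c * z = a * t\<close>
  follows from that on \<open>t\<close>.\<close>

lemma degen_exp_sums:
  assumes "lam \<noteq> 0" "vabs (lam * t) < r" "vabs t < r"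
  shows "(\<lambda>n. shifted lam x n y * (t ^ n / fact n)) sums degen_exp lam t (qnum q (x + of_nat y))"
proof -
  let ?a = "qnum q (x + of_nat y)"
  have "vabs ?a \<le> 1"
    using x by (intro vabs_qnum_le_1 vabs_add_le) auto
  then have "vabs (?a * t) \<le> 1 * vabs t"
    unfolding vabs_mult by (intro mult_right_mono) auto
  then have "(\<lambda>n. falling_fact (?a / lam) n * (lam * t) ^ n / fact n) sums
      degen_exp lam t ?a"
    unfolding degen_exp_def using assms by (intro padic_binomial_series) auto
  moreover have "shifted lam x n y = lam ^ n * falling_fact (?a / lam) n" for n
    unfolding shifted_def by (rule prod_diff_of_nat_mult[OF assms(1)])
  ultimately show ?thesis
    by (simp add: power_mult_distrib mult_ac)
qed

lemma beta_sums:
  assumes "lam \<noteq> 0" "vabs (lam * t) < r" "vabs t < r"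
  shows "(\<lambda>n. beta lam x n * (t ^ n / fact n)) sums
    padic_q_integral p q (\<lambda>y. degen_exp lam t (qnum q (x + y)))"
proof -
  let ?R = "max 1 (vabs lam)"
  \<comment> \<open>\<open>?R * vabs t\<close> is the larger of \<open>vabs t\<close> and
    \<open>vabs (lam * t)\<close>, so the two conditions on \<open>t\<close> together say
    \<open>s < 1\<close>.\<close>
  define s where "s = ?R * vabs t / r"
  have "?R * vabs t < r"
    using assms by (cases "vabs lam \<le> 1") (auto simp: vabs_mult max_def)
  then have s: "0 \<le> s" "s < 1"
    by (auto simp: s_def divide_less_eq)
  have bound: "vabs (moment N (shifted lam x n) * (t ^ n / fact n)) \<le> real (Suc n) * s ^ n" for N n
  proof -
    \<comment> \<open>Weakening the factorial bound by one factor \<open>r\<close> gives a clean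
      geometric ratio \<open>s\<close>.\<close>
    have "r ^ n \<le> r ^ (n - 1)"
      using r_less_1 by (intro power_decreasing) auto
    then have "vabs (t ^ n / fact n) \<le> vabs t ^ n / r ^ n"
      unfolding vabs_divide vabs_power using order_trans[OF _ vabs_fact_ge] by (intro frac_le) auto
    then have "vabs (moment N (shifted lam x n)) * vabs (t ^ n / fact n) \<le>
        ?R ^ n * real (Suc n) * (vabs t ^ n / r ^ n)"
      using vabs_moment_shifted_le by (intro mult_mono) auto
    also have "\<dots> = real (Suc n) * s ^ n"
      by (simp add: s_def power_mult_distrib power_divide)
    finally show ?thesis
      by (subst vabs_mult)
  qed
  have "(\<lambda>n. real n * s ^ n + s ^ n) \<longlonglongrightarrow> 0 + 0"
    using s by (intro tendsto_add powser_times_n_limit_0 LIMSEQ_power_zero) auto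
  then have B: "(\<lambda>n. real (Suc n) * s ^ n) \<longlonglongrightarrow> 0"
    by (simp add: algebra_simps)
  let ?f = "\<lambda>y. degen_exp lam t (qnum q (x + of_nat y))"
  have "(\<lambda>n. moment N (shifted lam x n) * (t ^ n / fact n)) sums moment N ?f" for N
  proof -
    have "(\<lambda>n. moment N (\<lambda>y. shifted lam x n y * (t ^ n / fact n))) sums moment N ?f"
      using assms by (intro moment_sums degen_exp_sums)
    moreover have "moment N (\<lambda>y. shifted lam x n y * (t ^ n / fact n)) =
        moment N (shifted lam x n) * (t ^ n / fact n)" for n
      \<comment> \<open>A sum over a singleton index set pulls the constant factor out of the
        moment.\<close>
      using moment_sum[of N "\<lambda>_. t ^ n / fact n" "\<lambda>_. shifted lam x n" "{()}"] by (simp add: mult.commute)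
    ultimately show ?thesis by simp
  qed
  then obtain l where l: "(\<lambda>n. beta lam x n * (t ^ n / fact n)) sums l" "(\<lambda>N. moment N ?f) \<longlonglongrightarrow> l"
    using dominated_sums[of "\<lambda>N n. moment N (shifted lam x n) * (t ^ n / fact n)"
        "\<lambda>n. beta lam x n * (t ^ n / fact n)" "\<lambda>n. real (Suc n) * s ^ n" "\<lambda>N. moment N ?f"]
      bound B tendsto_mult_right[OF moment_shifted_tendsto] by blast
  then show ?thesis
    unfolding padic_q_integral_conv_moment by (simp add: limI)
qed

lemma degen_carlitz_eq_beta:
  assumes "lam \<noteq> 0"
  shows "degen_carlitz p q lam x = beta lam x"
  unfolding degen_carlitz_def
proof (rule the_equality)
  show "\<forall>t. vabs (lam * t) < r \<and> vabs t < r \<longrightarrow> (\<lambda>n. beta lam x n * (t ^ n / fact n)) sums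
      padic_q_integral p q (\<lambda>y. degen_exp lam t (qnum q (x + y)))"
    using beta_sums[OF assms] by blast
next
  fix b
  assume b: "\<forall>t. vabs (lam * t) < r \<and> vabs t < r \<longrightarrow> (\<lambda>n. b n * (t ^ n / fact n)) sums
      padic_q_integral p q (\<lambda>y. degen_exp lam t (qnum q (x + y)))"
  \<comment> \<open>On this disc both conditions on \<open>t\<close> hold.\<close>
  define \<rho> where "\<rho> = min r (r / vabs lam)"
  have "(b n - beta lam x n) / fact n = 0" for n
  proof (rule power_series_zero_imp_zero)
    show "\<rho> > 0"
      using assms by (simp add: \<rho>_def)
    show "(of_nat p :: 'a) \<noteq> 0" "vabs (of_nat p :: 'a) < 1"
      using p_gt_1 by (auto simp: vabs_p)
    fix t :: 'a assume "vabs t < \<rho>"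
    then have "vabs (lam * t) < r" "vabs t < r"
      using assms by (auto simp: \<rho>_def vabs_mult pos_less_divide_eq mult.commute)
    then have "(\<lambda>n. b n * (t ^ n / fact n)) sums
        padic_q_integral p q (\<lambda>y. degen_exp lam t (qnum q (x + y)))"
      and "(\<lambda>n. beta lam x n * (t ^ n / fact n)) sums
        padic_q_integral p q (\<lambda>y. degen_exp lam t (qnum q (x + y)))"
      using b beta_sums[OF assms] by blast+
    then have "(\<lambda>n. b n * (t ^ n / fact n) + (- 1) * (beta lam x n * (t ^ n / fact n))) sums
        (padic_q_integral p q (\<lambda>y. degen_exp lam t (qnum q (x + y))) +
         (- 1) * padic_q_integral p q (\<lambda>y. degen_exp lam t (qnum q (x + y))))"
      by (intro sums_add sums_cmult)
    then show "(\<lambda>n. (b n - beta lam x n) / fact n * t ^ n) sums 0"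
      by (simp add: left_diff_distrib diff_divide_distrib)
  qed
  then show "b = beta lam x"
    by (simp add: fun_eq_iff)
qed

end

section \<open>The difference equation\<close>

lemma moment_shift:
  assumes x: "vabs x \<le> 1"
  shows "q * moment N (shifted lam (x + 1) n) - moment N (shifted lam x n) =
    (qpow q (of_nat (p ^ N)) * shifted lam x n (p ^ N) - shifted lam x n 0) / h N"
proof -
  define g where "g y = qpow q (of_nat y) * shifted lam x n y" for y
  have "shifted lam (x + 1) n y = shifted lam x n (Suc y)" for y
    by (simp add: shifted_def add_ac)
  \<comment> \<open>Replacing \<open>x\<close> by \<open>x + 1\<close> amounts to replacing
    \<open>y\<close> by \<open>y + 1\<close>, and the factor \<open>q\<close> adjusts the weight
    accordingly.\<close>
  then have "q * (shifted lam (x + 1) n y * qpow q (of_nat y)) = g (Suc y)" for y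
    using qpow_add[of 1 "of_nat y"] by (simp add: g_def mult_ac)
  then have "q * (\<Sum>y<p ^ N. shifted lam (x + 1) n y * qpow q (of_nat y)) -
      (\<Sum>y<p ^ N. shifted lam x n y * qpow q (of_nat y)) = (\<Sum>y<p ^ N. g (Suc y) - g y)"
    unfolding sum_distrib_left sum_subtractf by (simp add: g_def mult.commute)
  also have "\<dots> = g (p ^ N) - g 0"
    by (rule sum_lessThan_telescope)
  finally show ?thesis
    by (simp add: moment_def g_def diff_divide_distrib[symmetric])
qed

lemma beta_shift:
  assumes x: "vabs x \<le> 1" and lam: "lam \<noteq> 0"
  shows "q * beta lam (x + 1) n - beta lam x n =
    (q - 1) * lam ^ n * falling_fact (qnum q x / lam) n +
    (\<Sum>l = 1..n. of_int (stirling1 n l) * lam ^ (n - l) * of_nat l * qnum q x ^ (l - 1) * qpow q x)"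
proof (rule LIMSEQ_unique)
  define A where "A v = (\<Prod>i<n. v - of_nat i * lam)" for v
  define s where "s l = (of_int (stirling1 n l) * lam ^ (n - l) :: 'a)" for l
  define u w where "u = qnum q x" and "w = qpow q x"
  have A: "A v = (\<Sum>l\<le>n. s l * v ^ l)" for v
    by (simp add: A_def s_def prod_diff_conv_stirling1[OF lam])
  have uh: "(\<lambda>N. u + w * h N) \<longlonglongrightarrow> u"
    using tendsto_add[OF tendsto_const[of u] tendsto_mult_left[OF h_tendsto_0, of w]] by simp
  have "vabs (x + 1) \<le> 1"
    using x by (intro vabs_add_le) auto
  then show "(\<lambda>N. q * moment N (shifted lam (x + 1) n) - moment N (shifted lam x n))
      \<longlonglongrightarrow> q * beta lam (x + 1) n - beta lam x n"
    using x by (intro tendsto_diff tendsto_mult_left moment_shifted_tendsto)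
  have "q * moment N (shifted lam (x + 1) n) - moment N (shifted lam x n) =
      (q - 1) * A (u + w * h N) +
      (\<Sum>l\<le>n. s l * (w * (\<Sum>i<l. u ^ (l - Suc i) * (u + w * h N) ^ i)))" for N
  proof -
    \<comment> \<open>Each difference of powers has the factor \<open>w * h N\<close>; dividing
      \<open>h N\<close> out leaves an expression continuous at \<open>h N = 0\<close>, so no
      derivative need be taken.\<close>
    have "A (u + w * h N) - A u = h N *
        (\<Sum>l\<le>n. s l * (w * (\<Sum>i<l. u ^ (l - Suc i) * (u + w * h N) ^ i)))"
      unfolding A sum_subtractf[symmetric] sum_distrib_left[of "h N"] right_diff_distrib[symmetric]
        power_diff_sumr2 by (intro sum.cong refl) simp
    moreover have "q * moment N (shifted lam (x + 1) n) - moment N (shifted lam x n) =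
      ((1 + (q - 1) * h N) * A (u + w * h N) - A u) / h N"
      unfolding moment_shift[OF x]
      using qnum_add[OF x vabs_of_nat_le_1[of "p ^ N"]] qpow_conv_qnum[OF vabs_of_nat_le_1[of "p ^ N"]]
      by (simp add: shifted_def A_def u_def w_def)
    moreover have "\<dots> = (q - 1) * A (u + w * h N) + (A (u + w * h N) - A u) / h N"
      using h_neq_0[of N] by (simp add: field_simps)
    ultimately show ?thesis
      using h_neq_0[of N] by simp
  qed
  moreover have "(\<lambda>N. (q - 1) * A (u + w * h N) +
      (\<Sum>l\<le>n. s l * (w * (\<Sum>i<l. u ^ (l - Suc i) * (u + w * h N) ^ i)))) \<longlonglongrightarrow>
      (q - 1) * A u + (\<Sum>l\<le>n. s l * (w * (\<Sum>i<l. u ^ (l - Suc i) * u ^ i)))"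
    unfolding A_def
    by (intro tendsto_add tendsto_mult_left tendsto_prod' tendsto_diff tendsto_const tendsto_sum
        tendsto_power_strong uh)
  moreover have "(q - 1) * A u = (q - 1) * lam ^ n * falling_fact (qnum q x / lam) n"
    by (simp add: A_def u_def prod_diff_of_nat_mult[OF lam])
  moreover have "(\<Sum>l\<le>n. s l * (w * (\<Sum>i<l. u ^ (l - Suc i) * u ^ i))) =
      (\<Sum>l = 1..n. of_int (stirling1 n l) * lam ^ (n - l) * of_nat l * qnum q x ^ (l - 1) * qpow q x)"
  proof -
    \<comment> \<open>In the limit the two points coincide and the inner sum becomes the derivative
      of \<open>u ^ l\<close>. It is empty for \<open>l = 0\<close>, so the outer sum may start at
      1.\<close>
    have "(\<Sum>i<l. u ^ (l - Suc i) * u ^ i) = of_nat l * u ^ (l - 1)" for l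
      by (simp flip: power_add)
    then show ?thesis
      by (intro sum.mono_neutral_cong_right) (auto simp: s_def u_def w_def)
  qed
  ultimately show "(\<lambda>N. q * moment N (shifted lam (x + 1) n) - moment N (shifted lam x n)) \<longlonglongrightarrow>
    (q - 1) * lam ^ n * falling_fact (qnum q x / lam) n +
    (\<Sum>l = 1..n. of_int (stirling1 n l) * lam ^ (n - l) * of_nat l * qnum q x ^ (l - 1) * qpow q x)"
    by simp
qed

end

theorem theorem9:
  fixes p n :: nat
    and q lam x :: "'a::{nonarch_field, complete_space, alg_closed_field}"
  assumes "prime p"
    and "is_Cp p TYPE('a)"
    and "vabs (q - 1) < real p powr (- 1 / (real p - 1))"
    and "lam \<noteq> 0"
    and "x \<in> padic_integers"
  shows "q * degen_carlitz p q lam (x + 1) n - degen_carlitz p q lam x n =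
    (q - 1) * lam ^ n * falling_fact (qnum q x / lam) n +
    (\<Sum>l = 1..n. of_int (stirling1 n l) * lam ^ (n - l) * of_nat l * qnum q x ^ (l - 1) * qpow q x)"
proof -
  interpret padic_q p "TYPE('a)" q
    using assms(1-3) by unfold_locales (auto simp: is_Cp_def exp_radius_def)
  have x: "vabs x \<le> 1"
    using assms(5) by (simp add: padic_integers_def)
  moreover have "vabs (x + 1) \<le> 1"
    using x by (intro vabs_add_le) auto
  ultimately show ?thesis
    using assms(4) by (simp add: degen_carlitz_eq_beta beta_shift)
qed

end
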